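(* Let $X_N$ be an $N\times N$ complex Ginibre matrix with i.i.d. entries distributed as $\mathcal{CN}(0,1/N)$, let $A_N=X_N+uu^*$ (spike strength $\sigma=1$) with a deterministic unit vector $u\in\mathbb{C}^N$, and let $z_{\mathrm{out}}$ denote the outlier eigenvalue of $A_N$. There exists $c_0>0$ such that, as $N\to\infty$, $$\mathbb{E}[\operatorname{Re}(z_{\mathrm{out}})]\le 1+c_0\,N^{-1/4}+o(N^{-1/4}).$$
   Context: $\mathcal{CN}(0,1/N)$ is the centered circularly symmetric complex Gaussian distribution with variance $1/N$. By the matrix determinant lemma, $\det(zI-A_N)=\det(zI-X_N)\,h(z)$ with $h(z)=1-u^*(zI-X_N)^{-1}u$. The outlier eigenvalue $z_{\mathrm{out}}$ is the eigenvalue of $A_N$ associated with the spike, identified as a zero of $h$; here it is any (measurable) choice of such a zero. *)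

theory Defs
  imports
    "HOL-Probability.Probability"
    "HOL-Library.Landau_Symbols"
    "Jordan_Normal_Form.Gauss_Jordan_Elimination"
    "Jordan_Normal_Form.Char_Poly"
begin

text \<open>
  Density, with respect to Lebesgue measure on the complex plane, of the centered circularly
  symmetric complex Gaussian distribution with variance \<open>v > 0\<close>. Here \<open>v\<close> is the second absolute
  moment, so the real and imaginary parts are independent real Gaussians of variance \<open>v / 2\<close>.
\<close>

definition complex_normal_density :: "real \<Rightarrow> complex \<Rightarrow> real" where
  "complex_normal_density v z = exp (- (cmod z)\<^sup>2 / v) / (pi * v)"

definition ginibre :: "'w measure \<Rightarrow> nat \<Rightarrow> ('w \<Rightarrow> complex mat) \<Rightarrow> bool" where
  "ginibre M N X \<longleftrightarrow>
     (\<forall>w\<in>space M. X w \<in> carrier_mat N N) \<and>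
     prob_space.indep_vars M (\<lambda>_. borel) (\<lambda>(i, j) w. X w $$ (i, j)) ({..<N} \<times> {..<N}) \<and>
     (\<forall>i<N. \<forall>j<N. distributed M lborel (\<lambda>w. X w $$ (i, j))
                    (\<lambda>z. ennreal (complex_normal_density (1 / real N) z)))"

text \<open>
  Jordan_Normal_Form writes \<open>v \<bullet>c w\<close> for the inner product that is conjugate linear in \<open>w\<close>; in matrix
  notation it is \<open>w\<^sup>* v\<close>.
\<close>

definition unit_cvec :: "nat \<Rightarrow> complex vec \<Rightarrow> bool" where
  "unit_cvec N u \<longleftrightarrow> u \<in> carrier_vec N \<and> u \<bullet>c u = 1"

definition rank_one_proj :: "complex vec \<Rightarrow> complex mat" where
  "rank_one_proj u = mat (dim_vec u) (dim_vec u) (\<lambda>(i, j). vec_index u i * cnj (vec_index u j))"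

definition spiked :: "complex mat \<Rightarrow> complex vec \<Rightarrow> complex mat" where
  "spiked X u = X + rank_one_proj u"

text \<open>
  The resolvent \<open>(z I - X)\<^bsup>-1\<^esup>\<close>; it is meaningful only if \<open>z\<close> is not an eigenvalue of \<open>X\<close>.
\<close>

definition resolvent :: "complex mat \<Rightarrow> complex \<Rightarrow> complex mat" where
  "resolvent X z = the (mat_inverse (z \<cdot>\<^sub>m 1\<^sub>m (dim_row X) - X))"

definition secular_fun :: "complex mat \<Rightarrow> complex vec \<Rightarrow> complex \<Rightarrow> complex" where
  "secular_fun X u z = 1 - (resolvent X z *\<^sub>v u) \<bullet>c u"

text \<open>
  An outlier eigenvalue is an eigenvalue of the spiked matrix that is a zero of
  \<open>h(z) = 1 - u\<^sup>* (z I - X)\<^bsup>-1\<^esup> u\<close>, i.e. of \<open>secular_fun X u\<close>; the second conjunct says that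
  \<open>z\<close> lies in the domain of \<open>h\<close>.
\<close>

definition is_outlier :: "complex mat \<Rightarrow> complex vec \<Rightarrow> complex \<Rightarrow> bool" where
  "is_outlier X u z \<longleftrightarrow>
     eigenvalue (spiked X u) z \<and> \<not> eigenvalue X z \<and> secular_fun X u z = 0"

end

theory Submission
  imports Defs "HOL-Real_Asymp.Real_Asymp"
begin

text \<open>
  Let \<open>z\<close> be an outlier and \<open>v = (z - X)\<^sup>-\<^sup>1 u\<close>, so that \<open>u\<^sup>* v = 1\<close>. If the Neumann series converges, this
  reads \<open>z = 1 + \<Sum>\<^bsub>m \<ge> 1\<^esub> z\<^bsup>-m\<^esup> u\<^sup>* X\<^sup>m u\<close>. For \<open>1 \<le> m \<le> \<surd>N\<close> the form
  \<open>u\<^sup>* X\<^sup>m u\<close> has size \<open>N\<^bsup>-1/2\<^esup>\<close>. Hence an outlier with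
  \<open>|z| \<ge> 1 + s\<close> exceeds \<open>1\<close> in modulus by at most \<open>\<Sum>\<^bsub>m\<^esub> (1 + s)\<^bsup>-m\<^esup> |u\<^sup>* X\<^sup>m u|\<close>, whose expectation is of order
  \<open>N\<^bsup>-1/2\<^esup> / s\<close>. The choice \<open>s = N\<^bsup>-1/4\<^esup>\<close> makes this of order \<open>s\<close>. Because the absolute values
  are taken inside the sum, the bound is uniform in \<open>z\<close> and covers every choice of an outlier.

  The series is cut off at \<open>K\<close>, the integer part of \<open>\<surd>N\<close>. The lemma \<open>cmod_outlier_le\<close> shows, for every single
  matrix, that the cut costs at most
  \<open>2 (1 + s)\<^bsup>-K\<^esup> \<parallel>X\<^sup>K\<parallel> \<Sum>\<^bsub>m<K\<^esub> \<parallel>X\<^sup>m\<parallel>\<close> in Frobenius norms. The expectation of this is \<open>O(N\<^sup>2 (1 + s)\<^bsup>-K\<^esup>)\<close>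
  and therefore smaller than any power of \<open>N\<close>. There is no exceptional event to be treated separately.

  All the probability is in the bound \<open>E |(X\<^sup>k)\<^sub>i\<^sub>j|\<^sup>2 \<le> 3 / N\<close> for \<open>1 \<le> k \<le> \<surd>N\<close>
  (\<open>matpow_second_moment\<close>). Expand \<open>(X\<^sup>k)\<^sub>i\<^sub>j\<close> over walks from \<open>i\<close> to \<open>j\<close>. Monomials in
  independent circular Gaussians are orthogonal, with squared norm \<open>N\<^bsup>-k\<^esup> \<Prod> (multiplicity of the edge)!\<close>, so the second moment
  counts pairs of walks with the same edges. The number of walks with prescribed edges is at most the product of
  the factorials of the outdegrees, divided by the product of the factorials of the edge multiplicities
  (\<open>card_walks_with_edges\<close>). Summing the outdegree factorials over all walks of length \<open>k\<close> gives at
  most \<open>(N + 1) \<dots> (N + k - 1)\<close> (\<open>sum_walks_prod_fact_outdegree\<close>), which is at most \<open>3 N\<^bsup>k-1\<^esup>\<close> as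
  long as \<open>k\<^sup>2 \<le> N\<close>.
\<close>

section \<open>Moments of the complex Gaussian distribution\<close>

text \<open>
  A disc of squared radius \<open>t\<close> has area \<open>\<pi> t\<close>. This is the only trace of polar
  coordinates that the moment computation uses: it turns integrals of functions of \<open>|z|\<^sup>2\<close> over the
  plane into integrals over the half line.
\<close>

lemma distr_lborel_norm_squared:
  "distr lborel borel (\<lambda>z::complex. (cmod z)\<^sup>2) = density lborel (\<lambda>s. ennreal pi * indicator {0..} s)"
proof (rule measure_eqI_generator_eq)
  let ?E = "range (atMost :: real \<Rightarrow> real set)"
  show "Int_stable ?E"
    by (auto simp: Int_stable_def)
  show "sets (distr lborel borel (\<lambda>z::complex. (cmod z)\<^sup>2)) = sigma_sets UNIV ?E"
    and "sets (density lborel (\<lambda>s. ennreal pi * indicator {0..} s)) = sigma_sets UNIV ?E"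
    by (simp_all add: borel_eq_atMost)
  have L: "emeasure (distr lborel borel (\<lambda>z::complex. (cmod z)\<^sup>2)) {..t} = ennreal (if 0 \<le> t then pi * t else 0)" for t
  proof (cases "0 \<le> t")
    case True
    have "(\<lambda>z::complex. (cmod z)\<^sup>2) -` {..t} = cball 0 (sqrt t)"
      using True by (auto simp: real_le_rsqrt) (metis abs_norm_cancel real_sqrt_le_iff real_sqrt_abs sqrt_le_D)
    then show ?thesis
      using True by (simp add: emeasure_distr emeasure_cball unit_ball_vol_2)
  next
    case False
    then have "(\<lambda>z::complex. (cmod z)\<^sup>2) -` {..t} = {}"
      by (auto simp: not_le) (smt (verit) zero_le_power2)
    then show ?thesis using False by (simp add: emeasure_distr)
  qed
  have R: "emeasure (density lborel (\<lambda>s. ennreal pi * indicator {0..} s)) {..t} = ennreal (if 0 \<le> t then pi * t else 0)" for t :: real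
  proof -
    have "emeasure (density lborel (\<lambda>s. ennreal pi * indicator {0..} s)) {..t}
        = (\<integral>\<^sup>+s. ennreal pi * indicator ({0..t}) s \<partial>lborel)"
      by (subst emeasure_density) (auto intro!: nn_integral_cong split: split_indicator)
    then show ?thesis
      by (simp add: nn_integral_cmult ennreal_mult)
  qed
  show "emeasure (distr lborel borel (\<lambda>z::complex. (cmod z)\<^sup>2)) A
      = emeasure (density lborel (\<lambda>s. ennreal pi * indicator {0..} s)) A" if "A \<in> ?E" for A
    using that L R by auto
  show "emeasure (distr lborel borel (\<lambda>z::complex. (cmod z)\<^sup>2)) (atMost (real i)) \<noteq> \<infinity>" for i
    using L by simp
  show "range (\<lambda>i. {..real i}) \<subseteq> ?E" by auto
  show "(\<Union>i. {..real i}) = UNIV"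
    by (auto intro: real_arch_simple)
qed simp

text \<open>
  Under the complex Gaussian law \<open>|z|\<^sup>2\<close> is exponentially distributed with mean \<open>v\<close>, so its
  moments are those of an Erlang distribution with shape parameter \<open>0\<close>.
\<close>

lemma nn_integral_complex_normal_moment:
  assumes "0 < v"
  shows "(\<integral>\<^sup>+z. ennreal (complex_normal_density v z * cmod z ^ (2 * a)) \<partial>lborel) = ennreal (fact a * v ^ a)"
proof -
  have "(\<integral>\<^sup>+z. ennreal (complex_normal_density v z * cmod z ^ (2 * a)) \<partial>lborel)
      = (\<integral>\<^sup>+s. ennreal (exp (- s / v) / (pi * v) * s ^ a) \<partial>distr lborel borel (\<lambda>z::complex. (cmod z)\<^sup>2))"
    by (subst nn_integral_distr) (auto simp: complex_normal_density_def power_mult)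
  also have "\<dots> = (\<integral>\<^sup>+s. ennreal (erlang_density 0 (1 / v) s * s ^ a) \<partial>lborel)"
    unfolding distr_lborel_norm_squared using assms
    by (subst nn_integral_density)
       (auto intro!: nn_integral_cong simp: erlang_density_def ennreal_mult'[symmetric] split: split_indicator)
  also have "\<dots> = ennreal (fact a * v ^ a)"
    using assms by (subst nn_integral_erlang_ith_moment) (auto simp: power_divide)
  finally show ?thesis .
qed

lemma measurable_Complex_pair [measurable]:
  "(\<lambda>(x, y). Complex x y) \<in> borel_measurable borel"
proof -
  have "(\<lambda>(x, y). Complex x y) = (\<lambda>p. of_real (fst p) + \<i> * of_real (snd p))"
    by (auto simp: complex_eq_iff)
  then show ?thesis
    by (simp only:) (intro borel_measurable_continuous_onI continuous_intros)
qed

lemma lborel_complex_eq: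
  "lborel = distr (lborel :: (real \<times> real) measure) borel (\<lambda>(x, y). Complex x y)"
proof (rule lborel_eqI)
  fix l u :: complex
  assume lu: "\<And>b. b \<in> Basis \<Longrightarrow> l \<bullet> b \<le> u \<bullet> b"
  have lu': "Re l \<le> Re u" "Im l \<le> Im u"
    using lu[of 1] lu[of \<i>] by (auto simp: Basis_complex_def)
  have "(\<lambda>(x, y). Complex x y) -` box l u = box (Re l, Im l) (Re u, Im u)"
    by (auto simp: box_def Basis_complex_def Basis_prod_def)
  then show "emeasure (distr (lborel :: (real \<times> real) measure) borel (\<lambda>(x, y). Complex x y)) (box l u)
      = ennreal (\<Prod>b\<in>Basis. (u - l) \<bullet> b)"
    using lu' by (simp add: emeasure_distr emeasure_lborel_box_eq Basis_prod_def Basis_complex_def)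
qed simp

text \<open>
  By Fubini a shear is, on every line parallel to its direction, a translation.
\<close>

lemma nn_integral_lborel_shear:
  fixes f :: "real \<times> real \<Rightarrow> ennreal"
  assumes [measurable]: "f \<in> borel_measurable borel"
  shows "(\<integral>\<^sup>+p. f (fst p + t * snd p, snd p) \<partial>lborel) = (\<integral>\<^sup>+p. f p \<partial>lborel)"
    and "(\<integral>\<^sup>+p. f (fst p, snd p + t * fst p) \<partial>lborel) = (\<integral>\<^sup>+p. f p \<partial>lborel)"
proof -
  have tr: "(\<integral>\<^sup>+x. g (x + c) \<partial>lborel) = (\<integral>\<^sup>+x. g x \<partial>lborel)"
    if [measurable]: "g \<in> borel_measurable borel" for g :: "real \<Rightarrow> ennreal" and c
    using nn_integral_real_affine[of g 1 c] by (simp add: add.commute)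
  have f': "f \<in> borel_measurable (lborel \<Otimes>\<^sub>M lborel)"
    by (simp add: lborel_prod)
  have s1: "(\<lambda>p. f (fst p + t * snd p, snd p)) \<in> borel_measurable (lborel \<Otimes>\<^sub>M lborel)"
    and s2: "(\<lambda>p. f (fst p, snd p + t * fst p)) \<in> borel_measurable (lborel \<Otimes>\<^sub>M lborel)"
    unfolding lborel_prod
    by (simp_all add: borel_prod[symmetric])
  have sec: "(\<lambda>x. f (x, y)) \<in> borel_measurable borel" "(\<lambda>y. f (x, y)) \<in> borel_measurable borel" for x y
    using f' by (simp_all add: borel_prod[symmetric])
  show "(\<integral>\<^sup>+p. f (fst p + t * snd p, snd p) \<partial>lborel) = (\<integral>\<^sup>+p. f p \<partial>lborel)"
    unfolding lborel_prod[symmetric]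
    using lborel_pair.nn_integral_snd[OF s1] lborel_pair.nn_integral_snd[OF f'] tr[OF sec(1)]
    by simp
  show "(\<integral>\<^sup>+p. f (fst p, snd p + t * fst p) \<partial>lborel) = (\<integral>\<^sup>+p. f p \<partial>lborel)"
    unfolding lborel_prod[symmetric]
    using lborel.nn_integral_fst[OF s2] lborel.nn_integral_fst[OF f'] tr[OF sec(2)]
    by simp
qed

text \<open>
  A rotation of the plane is a product of three shears, the outer two with slope
  \<open>- tan (\<theta> / 2)\<close> and the middle one with slope \<open>sin \<theta>\<close>; the tangent is the reason for excluding
  \<open>\<theta> = \<pi>\<close>.
\<close>

lemma distr_lborel_rotation:
  assumes "\<bar>\<theta>\<bar> < pi"
  shows "distr lborel borel (\<lambda>z. cis \<theta> * z) = (lborel :: complex measure)"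
proof (rule measure_eqI)
  have [measurable]: "(\<lambda>z. cis \<theta> * z) \<in> borel_measurable borel"
    by (intro borel_measurable_continuous_onI continuous_intros)
  fix A :: "complex set" assume "A \<in> sets (distr lborel borel (\<lambda>z. cis \<theta> * z))"
  then have [measurable]: "A \<in> sets borel" by simp
  define t where "t = - tan (\<theta> / 2)"
  have cos: "cos (\<theta> / 2) \<noteq> 0"
  proof -
    have "0 < cos (\<theta> / 2)"
      using assms by (intro cos_gt_zero_pi) linarith+
    then show ?thesis by simp
  qed
  have cos2: "cos \<theta> = 2 * (cos (\<theta> / 2))\<^sup>2 - 1" and cos2': "cos \<theta> = 1 - 2 * (sin (\<theta> / 2))\<^sup>2"
    and sin2: "sin \<theta> = 2 * sin (\<theta> / 2) * cos (\<theta> / 2)"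
    using cos_double_cos[of "\<theta> / 2"] cos_double_sin[of "\<theta> / 2"] sin_double[of "\<theta> / 2"] by simp_all
  have "1 + t * sin \<theta> = cos \<theta>"
    unfolding cos2' sin2 using cos by (simp add: t_def tan_def power2_eq_square)
  moreover have "t * (1 + cos \<theta>) = - sin \<theta>"
    unfolding cos2 sin2 using cos by (simp add: t_def tan_def power2_eq_square)
  ultimately have tc: "1 + t * sin \<theta> = cos \<theta>" "t * (1 + cos \<theta>) = - sin \<theta>" .
  define g :: "real \<times> real \<Rightarrow> ennreal" where "g = (\<lambda>p. indicator A (Complex (fst p) (snd p)))"
  define g1 where "g1 = (\<lambda>p. g (fst p + t * snd p, snd p))"
  define g2 where "g2 = (\<lambda>p. g1 (fst p, snd p + sin \<theta> * fst p))"
  define g3 where "g3 = (\<lambda>p. g2 (fst p + t * snd p, snd p))"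
  have "g = (\<lambda>z. indicator A z) \<circ> (\<lambda>(x, y). Complex x y)"
    by (auto simp: g_def fun_eq_iff)
  then have mg [measurable]: "g \<in> borel_measurable borel"
    by simp
  have mg1 [measurable]: "g1 \<in> borel_measurable borel"
    unfolding g1_def by (rule measurable_compose[OF _ mg])
      (intro borel_measurable_continuous_onI continuous_intros)
  have mg2 [measurable]: "g2 \<in> borel_measurable borel"
    unfolding g2_def by (rule measurable_compose[OF _ mg1])
      (intro borel_measurable_continuous_onI continuous_intros)
  have g3: "g3 p = indicator A (cis \<theta> * Complex (fst p) (snd p))" for p
  proof -
    have "fst p + t * snd p + t * (snd p + sin \<theta> * (fst p + t * snd p))
        = (1 + t * sin \<theta>) * fst p + t * (1 + (1 + t * sin \<theta>)) * snd p"
      by (simp add: algebra_simps)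
    moreover have "snd p + sin \<theta> * (fst p + t * snd p) = sin \<theta> * fst p + (1 + t * sin \<theta>) * snd p"
      by (simp add: algebra_simps)
    ultimately show ?thesis
      unfolding g3_def g2_def g1_def g_def
      by (simp add: tc complex_eq_iff) (simp add: cis.ctr complex_mult add.commute)
  qed
  have "emeasure (distr lborel borel (\<lambda>z. cis \<theta> * z)) A = (\<integral>\<^sup>+z. indicator A z \<partial>distr lborel borel (\<lambda>z. cis \<theta> * z))"
    by simp
  also have "\<dots> = (\<integral>\<^sup>+z. indicator A (cis \<theta> * z) \<partial>(lborel :: complex measure))"
    by (rule nn_integral_distr) auto
  also have "\<dots> = (\<integral>\<^sup>+p. g3 p \<partial>lborel)"
    unfolding g3
    by (subst lborel_complex_eq, subst nn_integral_distr) (auto simp: case_prod_beta)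
  also have "\<dots> = (\<integral>\<^sup>+p. g p \<partial>lborel)"
    using nn_integral_lborel_shear(1)[OF mg, of t] nn_integral_lborel_shear(2)[OF mg1, of "sin \<theta>"]
      nn_integral_lborel_shear(1)[OF mg2, of t]
    by (simp only: g1_def g2_def g3_def)
  also have "\<dots> = (\<integral>\<^sup>+z. indicator A z \<partial>(lborel :: complex measure))"
    unfolding g_def
    by (subst lborel_complex_eq, subst nn_integral_distr) (auto simp: case_prod_beta)
  finally show "emeasure (distr lborel borel (\<lambda>z. cis \<theta> * z)) A = emeasure lborel A"
    by simp
qed simp

text \<open>
  Off the diagonal the moment vanishes by symmetry: the rotation by \<open>\<theta>\<close> preserves the law and
  multiplies \<open>z\<^sup>a cnj z\<^sup>b\<close> by \<open>exp (i \<theta> (a - b))\<close>. On the diagonal it is a moment of \<open>|z|\<^sup>2\<close>.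
\<close>

lemma complex_normal_moments:
  fixes Z :: "'w \<Rightarrow> complex"
  assumes v: "0 < v"
    and Z: "distributed M lborel Z (\<lambda>z. ennreal (complex_normal_density v z))"
  shows "integrable M (\<lambda>w. Z w ^ a * cnj (Z w) ^ b)"
    and "(\<integral>w. Z w ^ a * cnj (Z w) ^ b \<partial>M) = (if a = b then complex_of_real (fact a * v ^ a) else 0)"
proof -
  let ?d = "complex_normal_density v"
  have [measurable]: "?d \<in> borel_measurable borel"
    unfolding complex_normal_density_def by measurable
  have dpos: "0 \<le> ?d z" for z
    using v by (simp add: complex_normal_density_def)
  have [measurable]: "Z \<in> borel_measurable M"
    using Z by (simp add: distributed_def)
  have [measurable]: "(\<lambda>z. z ^ a * cnj z ^ b) \<in> borel_measurable borel"
    by (intro borel_measurable_continuous_onI continuous_intros)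
  have dens: "distr M lborel Z = density lborel (\<lambda>z. ennreal (?d z))"
    using Z by (simp add: distributed_def)
  have even: "has_bochner_integral lborel (\<lambda>z. ?d z * cmod z ^ (2 * c)) (fact c * v ^ c)" for c
    using v dpos by (intro has_bochner_integral_nn_integral)
      (auto simp: nn_integral_complex_normal_moment)
  have int: "integrable lborel (\<lambda>z. ?d z *\<^sub>R (z ^ a * cnj z ^ b))"
  proof (rule Bochner_Integration.integrable_bound)
    show "integrable lborel (\<lambda>z. ?d z * cmod z ^ (2 * a) + ?d z * cmod z ^ (2 * b))"
      using even by (auto simp: has_bochner_integral_iff)
    have "r ^ (a + b) \<le> r ^ (2 * a) + r ^ (2 * b)" if "0 \<le> r" for r :: real
    proof -
      have "2 * (r ^ a * r ^ b) \<le> (r ^ a)\<^sup>2 + (r ^ b)\<^sup>2"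
        using sum_squares_bound[of "r ^ a" "r ^ b"] by (simp add: mult.assoc)
      moreover have "0 \<le> r ^ a * r ^ b" using that by simp
      ultimately show ?thesis
        by (simp only: power_add mult_2 power2_eq_square)
    qed
    then have le: "cmod z ^ (a + b) \<le> cmod z ^ (2 * a) + cmod z ^ (2 * b)" for z
      by simp
    have "norm (?d z *\<^sub>R (z ^ a * cnj z ^ b)) \<le> norm (?d z * cmod z ^ (2 * a) + ?d z * cmod z ^ (2 * b))" for z
    proof -
      have "norm (?d z *\<^sub>R (z ^ a * cnj z ^ b)) = ?d z * cmod z ^ (a + b)"
        using dpos[of z] by (simp add: norm_mult norm_power power_add)
      also have "\<dots> \<le> ?d z * (cmod z ^ (2 * a) + cmod z ^ (2 * b))"
        by (rule mult_left_mono[OF le dpos])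
      finally show ?thesis by (simp add: distrib_left)
    qed
    then show "AE z in lborel. norm (?d z *\<^sub>R (z ^ a * cnj z ^ b))
        \<le> norm (?d z * cmod z ^ (2 * a) + ?d z * cmod z ^ (2 * b))"
      by simp
  qed simp
  show "integrable M (\<lambda>w. Z w ^ a * cnj (Z w) ^ b)"
  proof -
    have "integrable (distr M lborel Z) (\<lambda>z. z ^ a * cnj z ^ b)"
      unfolding dens using int dpos by (subst integrable_density) auto
    then show ?thesis by (subst (asm) integrable_distr_eq) auto
  qed
  have "(\<integral>w. Z w ^ a * cnj (Z w) ^ b \<partial>M) = (\<integral>z. z ^ a * cnj z ^ b \<partial>distr M lborel Z)"
    by (subst integral_distr) auto
  also have "\<dots> = (\<integral>z. ?d z *\<^sub>R (z ^ a * cnj z ^ b) \<partial>lborel)" (is "_ = ?I")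
    unfolding dens using dpos by (subst integral_density) auto
  also have "?I = (if a = b then complex_of_real (fact a * v ^ a) else 0)"
  proof (cases "a = b")
    case True
    have "z ^ a * cnj z ^ a = complex_of_real (cmod z ^ (2 * a))" for z
    proof -
      have "z ^ a * cnj z ^ a = (z * cnj z) ^ a" by (simp only: power_mult_distrib)
      also have "\<dots> = complex_of_real (((cmod z)\<^sup>2) ^ a)"
        by (simp add: complex_norm_square[symmetric])
      finally show ?thesis by (simp only: power_mult)
    qed
    then have "?I = (\<integral>z. complex_of_real (?d z * cmod z ^ (2 * a)) \<partial>lborel)"
      using True by (simp add: scaleR_conv_of_real)
    also have "\<dots> = complex_of_real (\<integral>z. ?d z * cmod z ^ (2 * a) \<partial>lborel)"
      by (rule integral_complex_of_real)
    finally show ?thesis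
      using True even[of a] by (simp add: has_bochner_integral_iff)
  next
    case False
    define m where "m = \<bar>real a - real b\<bar>"
    have m: "1 \<le> m" using False by (auto simp: m_def abs_if of_nat_diff) 
    \<comment> \<open>With this angle the factor is \<open>exp (\<plusminus> i)\<close>, which differs from \<open>1\<close>.\<close>
    define \<theta> where "\<theta> = 1 / m"
    have "\<bar>\<theta>\<bar> \<le> 1" using m by (simp add: \<theta>_def)
    then have "\<bar>\<theta>\<bar> < pi" using pi_gt3 by linarith
    define \<omega> where "\<omega> = cis \<theta> ^ a * cnj (cis \<theta>) ^ b"
    have "\<omega> = cis (\<theta> * (real a - real b))"
    proof -
      have "cnj (cis \<theta>) = cis (- \<theta>)" by (simp add: complex_eq_iff)
      then show ?thesis
        by (simp only: \<omega>_def Complex.DeMoivre cis_mult) (rule arg_cong[of _ _ cis], simp add: algebra_simps)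
    qed
    moreover have "\<theta> * (real a - real b) = 1 \<or> \<theta> * (real a - real b) = - 1"
      using m by (auto simp: \<theta>_def m_def abs_if field_simps)
    moreover have "cos (1::real) \<noteq> 1"
      using cos_monotone_0_pi[of 0 1] pi_gt3 by simp
    ultimately have "\<omega> \<noteq> 1"
      by (auto simp: complex_eq_iff)
    have "?I = (\<integral>z. ?d z *\<^sub>R (z ^ a * cnj z ^ b) \<partial>distr lborel borel (\<lambda>z. cis \<theta> * z))"
      using \<open>\<bar>\<theta>\<bar> < pi\<close> by (subst distr_lborel_rotation) auto
    also have "\<dots> = (\<integral>z. ?d (cis \<theta> * z) *\<^sub>R ((cis \<theta> * z) ^ a * cnj (cis \<theta> * z) ^ b) \<partial>lborel)"
      by (subst integral_distr)
        (auto intro!: borel_measurable_continuous_onI continuous_intros)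
    also have "\<dots> = (\<integral>z. \<omega> * (?d z *\<^sub>R (z ^ a * cnj z ^ b)) \<partial>lborel)"
      by (intro Bochner_Integration.integral_cong)
        (auto simp: complex_normal_density_def norm_mult \<omega>_def power_mult_distrib scaleR_conv_of_real)
    also have "\<dots> = \<omega> * ?I"
      by (rule integral_mult_right_zero)
    finally have "(1 - \<omega>) * ?I = 0" by (simp add: algebra_simps)
    then show ?thesis using False \<open>\<omega> \<noteq> 1\<close> by simp
  qed
  finally show "(\<integral>w. Z w ^ a * cnj (Z w) ^ b \<partial>M) = (if a = b then complex_of_real (fact a * v ^ a) else 0)" .
qed

section \<open>Walks and matrix powers\<close>

text \<open>
  Walks from \<open>i\<close> to \<open>j\<close> are lists of edges rather than of vertices: the Gaussian moment of the
  corresponding product of entries depends only on the multiset of edges.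
\<close>

fun walks :: "nat \<Rightarrow> nat \<Rightarrow> nat \<Rightarrow> nat \<Rightarrow> (nat \<times> nat) list set" where
  "walks N 0 i j = (if i = j then {[]} else {})"
| "walks N (Suc k) i j = (\<Union>l<N. (#) (i, l) ` walks N k l j)"

text \<open>
  Entries of powers of the matrix \<open>(x (i, j))\<close>, as a bare function of the array \<open>x\<close>, so that \<open>x\<close>
  can be a family of random variables indexed by positions.
\<close>

fun matpow :: "nat \<Rightarrow> (nat \<times> nat \<Rightarrow> complex) \<Rightarrow> nat \<Rightarrow> nat \<Rightarrow> nat \<Rightarrow> complex" where
  "matpow N x 0 i j = (if i = j then 1 else 0)"
| "matpow N x (Suc k) i j = (\<Sum>l<N. x (i, l) * matpow N x k l j)"

lemma finite_walks [simp]: "finite (walks N k i j)"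
  by (induct k arbitrary: i) auto

lemma sum_walks_Suc:
  "(\<Sum>es\<in>walks N (Suc k) i j. f es) = (\<Sum>l<N. \<Sum>es\<in>walks N k l j. f ((i, l) # es))"
proof -
  have "(\<Sum>es\<in>walks N (Suc k) i j. f es) = (\<Sum>l<N. \<Sum>es\<in>(#) (i, l) ` walks N k l j. f es)"
    unfolding walks.simps by (rule sum.UNION_disjoint) auto
  also have "\<dots> = (\<Sum>l<N. \<Sum>es\<in>walks N k l j. f ((i, l) # es))"
    by (simp add: sum.reindex)
  finally show ?thesis .
qed

lemma matpow_eq_sum_walks:
  "matpow N x k i j = (\<Sum>es\<in>walks N k i j. prod_list (map x es))"
  by (induct k arbitrary: i) (simp_all add: sum_walks_Suc sum_distrib_left del: walks.simps(2))

lemma walks_length_edges: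
  assumes "es \<in> walks N k i j" "i < N" 
  shows "length es = k" "set es \<subseteq> {..<N} \<times> {..<N}"
  using assms by (induct k arbitrary: i es) (auto split: if_splits, fastforce+)

text \<open>
  Every vertex is entered as often as it is left, up to the two ends. Hence the multiset of edges of
  an open walk determines its ends, and that of a closed walk reveals that it is closed.
\<close>

lemma walks_endpoints:
  assumes "es \<in> walks N k i j"
  shows "add_mset j (image_mset fst (mset es)) = add_mset i (image_mset snd (mset es))"
  using assms by (induct k arbitrary: i es) (auto split: if_splits)

lemma walks_same_edges:
  assumes "es \<in> walks N k i j" "fs \<in> walks N k i' j'" "mset es = mset fs"
  shows "(i = i' \<and> j = j') \<or> (i = j \<and> i' = j')"
proof -
  let ?S = "image_mset fst (mset es)" and ?T = "image_mset snd (mset es)"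
  have "add_mset j ?S = add_mset i ?T" "add_mset j' ?S = add_mset i' ?T"
    using walks_endpoints[OF assms(1)] walks_endpoints[OF assms(2)] assms(3) by simp_all
  then have "add_mset j (add_mset i' ?T) = add_mset j' (add_mset i ?T)"
    by (metis add_mset_commute)
  then have "{#j, i'#} + ?T = {#j', i#} + ?T" by simp
  then have "{#j, i'#} = {#j', i#}" by (simp only: add_right_cancel)
  then show ?thesis by (auto simp: add_eq_conv_ex)
qed

lemma prod_fact_Suc:
  assumes "finite E" "a \<in> E"
  shows "(\<Prod>e\<in>E. fact (if e = a then Suc (c e) else c e) :: nat) = Suc (c a) * (\<Prod>e\<in>E. fact (c e))"
proof -
  have "(\<Prod>e\<in>E. fact (if e = a then Suc (c e) else c e) :: nat)
      = fact (Suc (c a)) * (\<Prod>e\<in>E - {a}. fact (if e = a then Suc (c e) else c e))"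
    using assms by (subst prod.remove) auto
  also have "(\<Prod>e\<in>E - {a}. fact (if e = a then Suc (c e) else c e) :: nat) = (\<Prod>e\<in>E - {a}. fact (c e))"
    by (intro prod.cong) auto
  finally show ?thesis
    using assms by (simp add: prod.remove[of E a] algebra_simps)
qed

text \<open>
  Number the parallel copies of every edge in \<open>A\<close>. A walk that uses each numbered copy once is
  fixed by its start and the order in which it leaves each vertex along the copies that start there, and \<open>v\<close> offers
  at most \<open>(outdegree of v)!\<close> orders; on the other side every walk is counted once for each numbering
  of its edges. The formal proof removes the first edge of the walk.
\<close>

lemma card_walks_with_edges:
  assumes "i < N"
  shows "card {es \<in> walks N k i j. mset es = A} * (\<Prod>e\<in>{..<N} \<times> {..<N}. fact (count A e))
    \<le> (\<Prod>v<N. fact (count (image_mset fst A) v) :: nat)"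
  using assms
proof (induct k arbitrary: i A)
  case 0
  have "{es \<in> walks N 0 i j. mset es = A} = (if i = j \<and> A = {#} then {[]} else {})"
    by auto
  then show ?case by (auto intro: prod_ge_1)
next
  case (Suc k)
  let ?E = "{..<N} \<times> {..<N}"
  let ?W = "\<lambda>l. {es \<in> walks N k l j. mset es = A - {#(i, l)#}}"
  let ?d = "\<lambda>A. count (image_mset fst A)"
  define L where "L = {l. l < N \<and> (i, l) \<in># A}"
  have fL: "finite L" by (simp add: L_def)
  have "{es \<in> walks N (Suc k) i j. mset es = A} = (\<Union>l\<in>L. (#) (i, l) ` ?W l)"
    by (auto simp: L_def)
  then have card: "card {es \<in> walks N (Suc k) i j. mset es = A} \<le> (\<Sum>l\<in>L. card (?W l))"
    using card_UN_le[OF fL, of "\<lambda>l. (#) (i, l) ` ?W l"] by (simp add: card_image)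
  \<comment> \<open>The product of the factorials after removal of one edge out of \<open>i\<close>; it does not depend on its head \<open>l\<close>.\<close>
  define Q :: nat where "Q = (\<Prod>v<N. fact (if v = i then ?d A v - 1 else ?d A v))"
  have step: "card (?W l) * (\<Prod>e\<in>?E. fact (count A e)) \<le> count A (i, l) * Q"
    and D: "(\<Prod>v<N. fact (?d A v)) = ?d A i * Q" if l: "l \<in> L" for l
  proof -
    obtain B where B: "A = add_mset (i, l) B"
      using l by (auto simp: L_def dest: multi_member_split)
    have "count A = (\<lambda>e. if e = (i, l) then Suc (count B e) else count B e)"
      by (auto simp: B)
    then have "(\<Prod>e\<in>?E. fact (count A e) :: nat) = count A (i, l) * (\<Prod>e\<in>?E. fact (count B e))"
      using prod_fact_Suc[of ?E "(i, l)" "count B"] l Suc.prems by (simp add: L_def)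
    moreover have "card (?W l) * (\<Prod>e\<in>?E. fact (count B e)) \<le> (\<Prod>v<N. fact (?d B v))"
      using Suc.hyps[of l B] l by (simp add: B L_def)
    moreover have "(\<Prod>v<N. fact (?d B v)) = Q"
      unfolding Q_def B by (intro prod.cong) auto
    ultimately show "card (?W l) * (\<Prod>e\<in>?E. fact (count A e)) \<le> count A (i, l) * Q"
      using mult_le_mono2[of "card (?W l) * (\<Prod>e\<in>?E. fact (count B e))" Q "count A (i, l)"]
      by (simp only: mult.left_commute)
    have "?d A = (\<lambda>v. if v = i then Suc (?d B v) else ?d B v)"
      by (auto simp: B)
    then have "(\<Prod>v<N. fact (?d A v) :: nat) = ?d A i * (\<Prod>v<N. fact (?d B v))"
      using prod_fact_Suc[of "{..<N}" i "?d B"] Suc.prems by simp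
    then show "(\<Prod>v<N. fact (?d A v)) = ?d A i * Q"
      using \<open>(\<Prod>v<N. fact (?d B v)) = Q\<close> by simp
  qed
  show ?case
  proof (cases "L = {}")
    case True
    then have "card {es \<in> walks N (Suc k) i j. mset es = A} = 0"
      using card by (simp del: walks.simps card_eq_0_iff)
    then show ?thesis by (simp only: mult_0 le0)
  next
    case False
    have "card {es \<in> walks N (Suc k) i j. mset es = A} * (\<Prod>e\<in>?E. fact (count A e))
        \<le> (\<Sum>l\<in>L. card (?W l) * (\<Prod>e\<in>?E. fact (count A e)))"
      using mult_le_mono1[OF card] by (simp add: sum_distrib_right)
    also have "\<dots> \<le> (\<Sum>l\<in>L. count A (i, l)) * Q"
      using step by (simp add: sum_distrib_right sum_mono)
    also have "(\<Sum>l\<in>L. count A (i, l)) \<le> ?d A i"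
    proof -
      have "(\<Sum>l\<in>L. count A (i, l)) = (\<Sum>e\<in>Pair i ` L. count A e)"
        by (subst sum.reindex) (auto simp: inj_on_def)
      also have "\<dots> \<le> (\<Sum>e\<in>fst -` {i} \<inter> set_mset A. count A e)"
        by (rule sum_mono2) (auto simp: L_def)
      finally show ?thesis by (simp add: count_image_mset)
    qed
    also have "?d A i * Q = (\<Prod>v<N. fact (?d A v))"
      using D False by auto
    finally show ?thesis by simp
  qed
qed

text \<open>
  The bound of the previous lemma, summed over all walks, has a closed form: one more
  departure from a vertex \<open>l\<close> multiplies the product of factorials by \<open>c l + 1\<close>, and these factors add
  up to \<open>N\<close> plus the number of departures so far. The offset \<open>c\<close> records the departures already
  made, which makes the induction on the length go through.
\<close>

lemma sum_walks_prod_fact_outdegree: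
  assumes "i < N"
  shows "(\<Sum>es\<in>walks N (Suc k) i j. \<Prod>v<N. fact (c v + count (image_mset fst (mset es)) v) :: nat)
    \<le> (\<Prod>v<N. fact (c v)) * Suc (c i) * (\<Prod>m=1..k. N + (\<Sum>v<N. c v) + m)"
  using assms
proof (induct k arbitrary: i c)
  case 0
  have "(\<Sum>es\<in>walks N (Suc 0) i j. \<Prod>v<N. fact (c v + count (image_mset fst (mset es)) v) :: nat)
     = (\<Sum>l<N. if l = j then \<Prod>v<N. fact (if v = i then Suc (c v) else c v) else 0)"
    unfolding sum_walks_Suc by (intro sum.cong refl) (auto intro!: prod.cong)
  then show ?case
    using 0 by (simp add: prod_fact_Suc)
next
  case (Suc k)
  let ?c = "\<lambda>v. if v = i then Suc (c v) else c v"
  let ?S = "\<Sum>v<N. c v"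
  have S: "(\<Sum>v<N. ?c v) = Suc ?S"
  proof -
    have "(\<Sum>v<N. ?c v) = (\<Sum>v<N. c v + (if v = i then 1 else 0))"
      by (intro sum.cong) auto
    then show ?thesis using Suc.prems by (simp add: sum.distrib)
  qed
  have "(\<Sum>es\<in>walks N (Suc (Suc k)) i j. \<Prod>v<N. fact (c v + count (image_mset fst (mset es)) v) :: nat)
    = (\<Sum>l<N. \<Sum>es\<in>walks N (Suc k) l j. \<Prod>v<N. fact (?c v + count (image_mset fst (mset es)) v))"
    unfolding sum_walks_Suc[of _ N "Suc k"] by (intro sum.cong prod.cong refl) auto
  also have "\<dots> \<le> (\<Sum>l<N. (\<Prod>v<N. fact (?c v)) * Suc (?c l) * (\<Prod>m=1..k. N + (\<Sum>v<N. ?c v) + m))"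
    by (intro sum_mono Suc.hyps) simp
  also have "\<dots> = (\<Prod>v<N. fact (c v)) * Suc (c i) * ((N + Suc ?S) * (\<Prod>m=1..k. N + Suc ?S + m))"
  proof -
    have "(\<Sum>l<N. Suc (?c l)) = N + Suc ?S"
      using S by (simp add: sum.distrib[of "\<lambda>_. 1" ?c, simplified])
    moreover have "(\<Prod>v<N. fact (?c v)) = Suc (c i) * (\<Prod>v<N. fact (c v))"
      using Suc.prems by (simp only: prod_fact_Suc finite_lessThan lessThan_iff)
    ultimately show ?thesis
      unfolding sum_distrib_left[symmetric] sum_distrib_right[symmetric] S by (simp only: mult_ac)
  qed
  also have "(N + Suc ?S) * (\<Prod>m=1..k. N + Suc ?S + m) = (\<Prod>m=1..Suc k. N + ?S + m)"
  proof -
    have "(\<Prod>m=1..Suc k. N + ?S + m) = (N + ?S + 1) * (\<Prod>m=Suc 1..Suc k. N + ?S + m)"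
      by (subst prod.atLeast_Suc_atMost) auto
    also have "(\<Prod>m=Suc 1..Suc k. N + ?S + m) = (\<Prod>m=1..k. N + Suc ?S + m)"
      by (subst prod.shift_bounds_cl_Suc_ivl) simp
    finally show ?thesis by simp
  qed
  finally show ?case .
qed

text \<open>
  Up to the factor \<open>N\<^bsup>-(k+1)\<^esup>\<close> this is the second moment of an entry of \<open>X\<^bsup>k+1\<^esup>\<close>. Grouping the pairs by
  the first walk reduces it to the two preceding counts.
\<close>

lemma sum_walk_pairs_same_edges:
  assumes "i < N"
  shows "(\<Sum>es\<in>walks N (Suc k) i j. \<Sum>fs\<in>walks N (Suc k) i j.
      if mset es = mset fs then \<Prod>e\<in>{..<N} \<times> {..<N}. fact (count (mset es) e) else 0 :: nat)
    \<le> (\<Prod>m=1..k. N + m)"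
proof -
  let ?W = "walks N (Suc k) i j" and ?P = "\<lambda>A. \<Prod>e\<in>{..<N} \<times> {..<N}. fact (count A e) :: nat"
  have "(\<Sum>es\<in>?W. \<Sum>fs\<in>?W. if mset es = mset fs then ?P (mset es) else 0)
      = (\<Sum>es\<in>?W. card {fs \<in> ?W. mset fs = mset es} * ?P (mset es))"
  proof (intro sum.cong refl)
    fix es
    have "(\<Sum>fs\<in>?W. if mset es = mset fs then ?P (mset es) else 0) = (\<Sum>fs\<in>{fs \<in> ?W. mset fs = mset es}. ?P (mset es))"
      by (intro sum.mono_neutral_cong_right) auto
    then show "(\<Sum>fs\<in>?W. if mset es = mset fs then ?P (mset es) else 0) = card {fs \<in> ?W. mset fs = mset es} * ?P (mset es)"
      by (simp del: walks.simps)
  qed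
  also have "\<dots> \<le> (\<Sum>es\<in>?W. \<Prod>v<N. fact (0 + count (image_mset fst (mset es)) v))"
    using card_walks_with_edges[OF assms] by (intro sum_mono) (simp del: walks.simps)
  also have "\<dots> \<le> (\<Prod>m=1..k. N + m)"
    using sum_walks_prod_fact_outdegree[OF assms, where c = "\<lambda>_. 0"] by simp
  finally show ?thesis .
qed

section \<open>Second moments of powers of a Ginibre matrix\<close>

lemma prod_list_map_eq_prod_count:
  fixes f :: "'a \<Rightarrow> 'b::comm_monoid_mult"
  assumes "finite E" "set es \<subseteq> E"
  shows "prod_list (map f es) = (\<Prod>e\<in>E. f e ^ count (mset es) e)"
  using assms(2)
proof (induct es)
  case (Cons a es)
  have "(\<Prod>e\<in>E. f e ^ count (mset (a # es)) e) = (\<Prod>e\<in>E. (if e = a then f e else 1) * f e ^ count (mset es) e)"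
    by (intro prod.cong) auto
  then show ?case
    using Cons assms(1) by (simp add: prod.distrib)
qed simp

text \<open>
  The quotient of the two sides, up to the constant, is \<open>\<Prod> (1 + m / N) \<le> exp (k\<^sup>2 / N)\<close>. This is
  what confines the moment bounds to powers up to \<open>\<surd>N\<close>.
\<close>

lemma prod_add_le_power:
  assumes "1 \<le> N" "k\<^sup>2 \<le> N"
  shows "real (\<Prod>m=1..k. N + m) \<le> 3 * real N ^ k"
proof -
  have "real (\<Prod>m=1..k. N + m) \<le> (\<Prod>m=1..k. real N * exp (real k / real N))"
    unfolding of_nat_prod
  proof (intro prod_mono conjI)
    fix m assume "m \<in> {1..k}"
    then have "1 + real m / real N \<le> 1 + real k / real N"
      using assms by (simp add: divide_right_mono)
    also have "\<dots> \<le> exp (real k / real N)"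
      by (rule exp_ge_add_one_self)
    finally have "real N * (1 + real m / real N) \<le> real N * exp (real k / real N)"
      by (intro mult_left_mono) auto
    then show "real (N + m) \<le> real N * exp (real k / real N)"
      using assms by (simp add: algebra_simps)
  qed simp
  also have "\<dots> = real N ^ k * exp (real k * (real k / real N))"
    by (simp only: power_mult_distrib exp_of_nat_mult prod_constant card_atLeastAtMost diff_Suc_1)
  finally have le: "real (\<Prod>m=1..k. N + m) \<le> real N ^ k * exp (real k * (real k / real N))" .
  have "exp (real k * (real k / real N)) \<le> exp 1"
  proof -
    have "real k * real k \<le> real N"
      using assms(2) by (metis of_nat_le_iff of_nat_mult power2_eq_square)
    then show ?thesis using assms(1) by (simp add: field_simps)
  qed
  also have "exp (1::real) \<le> 3" by (rule exp_le)
  finally have "real N ^ k * exp (real k * (real k / real N)) \<le> real N ^ k * 3"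
    by (intro mult_left_mono) auto
  with le show ?thesis by linarith
qed

locale complex_normal_entries = prob_space M for M :: "'w measure" +
  fixes N :: nat and Z :: "nat \<times> nat \<Rightarrow> 'w \<Rightarrow> complex"
  assumes N_pos: "1 \<le> N"
    and indep: "indep_vars (\<lambda>_. borel) Z ({..<N} \<times> {..<N})"
    and normal: "\<And>e. e \<in> {..<N} \<times> {..<N} \<Longrightarrow>
      distributed M lborel (Z e) (\<lambda>z. ennreal (complex_normal_density (1 / real N) z))"
begin

abbreviation "E \<equiv> {..<N} \<times> {..<N}"

abbreviation "P k i j w \<equiv> matpow N (\<lambda>e. Z e w) k i j"

lemma measurable_entry [measurable]: "e \<in> E \<Longrightarrow> Z e \<in> borel_measurable M"
  using normal by (simp add: distributed_def)

lemma measurable_P [measurable]: "i < N \<Longrightarrow> P k i j \<in> borel_measurable M"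
  by (induct k arbitrary: i) auto

lemma monomial_moments:
  shows "integrable M (\<lambda>w. (\<Prod>e\<in>E. Z e w ^ a e) * cnj (\<Prod>e\<in>E. Z e w ^ b e))"
    and "expectation (\<lambda>w. (\<Prod>e\<in>E. Z e w ^ a e) * cnj (\<Prod>e\<in>E. Z e w ^ b e))
      = (\<Prod>e\<in>E. if a e = b e then complex_of_real (fact (a e) * (1 / real N) ^ a e) else 0)"
proof -
  let ?Y = "\<lambda>e w. Z e w ^ a e * cnj (Z e w) ^ b e"
  have eq: "(\<Prod>e\<in>E. Z e w ^ a e) * cnj (\<Prod>e\<in>E. Z e w ^ b e) = (\<Prod>e\<in>E. ?Y e w)" for w
    by (simp add: prod.distrib)
  have "(\<lambda>z. z ^ m * cnj z ^ n) \<in> borel_measurable borel" for m n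
    by (intro borel_measurable_continuous_onI continuous_intros)
  then have ind: "indep_vars (\<lambda>_. borel) ?Y E"
    using indep_vars_compose2[OF indep, of "\<lambda>e z. z ^ a e * cnj z ^ b e" "\<lambda>_. borel"] by simp
  have int: "integrable M (?Y e)" if "e \<in> E" for e
    using complex_normal_moments(1)[OF _ normal[OF that]] N_pos by simp
  show "integrable M (\<lambda>w. (\<Prod>e\<in>E. Z e w ^ a e) * cnj (\<Prod>e\<in>E. Z e w ^ b e))"
    unfolding eq by (rule indep_vars_integrable[OF _ ind int]) auto
  have "expectation (\<lambda>w. \<Prod>e\<in>E. ?Y e w) = (\<Prod>e\<in>E. expectation (?Y e))"
    by (rule indep_vars_lebesgue_integral[OF _ ind int]) auto
  also have "\<dots> = (\<Prod>e\<in>E. if a e = b e then complex_of_real (fact (a e) * (1 / real N) ^ a e) else 0)"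
    using complex_normal_moments(2)[OF _ normal] N_pos by (intro prod.cong refl) simp
  finally show "expectation (\<lambda>w. (\<Prod>e\<in>E. Z e w ^ a e) * cnj (\<Prod>e\<in>E. Z e w ^ b e))
      = (\<Prod>e\<in>E. if a e = b e then complex_of_real (fact (a e) * (1 / real N) ^ a e) else 0)"
    unfolding eq .
qed

text \<open>
  Independence factors the moment over the edges. An edge that the two walks use with different
  multiplicities contributes a factor \<open>0\<close>, and the remaining factors are moments of \<open>|Z e|\<^sup>2\<close>.
\<close>

lemma walk_moments:
  assumes "es \<in> walks N k i j" "fs \<in> walks N k i' j'" "i < N" "i' < N"
  shows "integrable M (\<lambda>w. prod_list (map (\<lambda>e. Z e w) es) * cnj (prod_list (map (\<lambda>e. Z e w) fs)))"
    and "expectation (\<lambda>w. prod_list (map (\<lambda>e. Z e w) es) * cnj (prod_list (map (\<lambda>e. Z e w) fs)))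
      = complex_of_real (real (if mset es = mset fs then \<Prod>e\<in>E. fact (count (mset es) e) else 0) / real N ^ k)"
proof -
  have es: "set es \<subseteq> E" "length es = k" and fs: "set fs \<subseteq> E"
    using walks_length_edges assms by blast+
  have fin: "finite E" by simp
  note eq = prod_list_map_eq_prod_count[OF fin es(1)] prod_list_map_eq_prod_count[OF fin fs]
  show "integrable M (\<lambda>w. prod_list (map (\<lambda>e. Z e w) es) * cnj (prod_list (map (\<lambda>e. Z e w) fs)))"
    unfolding eq by (rule monomial_moments)
  have "expectation (\<lambda>w. prod_list (map (\<lambda>e. Z e w) es) * cnj (prod_list (map (\<lambda>e. Z e w) fs)))
    = (\<Prod>e\<in>E. if count (mset es) e = count (mset fs) e
          then complex_of_real (fact (count (mset es) e) * (1 / real N) ^ count (mset es) e) else 0)"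
    unfolding eq by (rule monomial_moments)
  also have "\<dots> = complex_of_real (real (if mset es = mset fs then \<Prod>e\<in>E. fact (count (mset es) e) else 0) / real N ^ k)"
  proof (cases "mset es = mset fs")
    case True
    have "(\<Sum>e\<in>E. count (mset es) e) = k"
    proof -
      have "(\<Sum>e\<in>E. count (mset es) e) = (\<Sum>e\<in>set es. count (mset es) e)"
        using es(1) by (intro sum.mono_neutral_right) (auto simp: count_eq_zero_iff)
      then show ?thesis using es(2) by (simp add: size_multiset_overloaded_eq[symmetric] flip: set_mset_mset)
    qed
    then have "(\<Prod>e\<in>E. (1 / real N) ^ count (mset es) e) = (1 / real N) ^ k"
      by (simp add: power_sum[symmetric])
    then have "(\<Prod>e\<in>E. fact (count (mset es) e) * (1 / real N) ^ count (mset es) e)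
       = (\<Prod>e\<in>E. fact (count (mset es) e)) * (1 / real N) ^ k"
      by (simp only: prod.distrib)
    then show ?thesis
      using True by (simp only: of_real_prod[symmetric] if_True simp_thms) (simp add: power_one_over divide_simps)
  next
    case False
    then obtain e where e: "count (mset es) e \<noteq> count (mset fs) e"
      by (meson multiset_eqI)
    then have "e \<in># mset es \<or> e \<in># mset fs"
      by (metis not_in_iff)
    then have "e \<in> E" using es(1) fs by auto
    then have "(\<Prod>e\<in>E. if count (mset es) e = count (mset fs) e
          then complex_of_real (fact (count (mset es) e) * (1 / real N) ^ count (mset es) e) else 0) = 0"
      using e by (intro prod_zero) auto
    then show ?thesis using False by simp
  qed
  finally show "expectation (\<lambda>w. prod_list (map (\<lambda>e. Z e w) es) * cnj (prod_list (map (\<lambda>e. Z e w) fs)))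
      = complex_of_real (real (if mset es = mset fs then \<Prod>e\<in>E. fact (count (mset es) e) else 0) / real N ^ k)" .
qed

lemma matpow_covariance:
  assumes "i < N" "i' < N"
  shows "integrable M (\<lambda>w. P k i j w * cnj (P k i' j' w))"
    and "expectation (\<lambda>w. P k i j w * cnj (P k i' j' w)) =
      complex_of_real (real (\<Sum>es\<in>walks N k i j. \<Sum>fs\<in>walks N k i' j'.
        if mset es = mset fs then \<Prod>e\<in>E. fact (count (mset es) e) else 0) / real N ^ k)"
proof -
  have eq: "P k i j w * cnj (P k i' j' w) = (\<Sum>es\<in>walks N k i j. \<Sum>fs\<in>walks N k i' j'.
      prod_list (map (\<lambda>e. Z e w) es) * cnj (prod_list (map (\<lambda>e. Z e w) fs)))" for w
    by (simp add: matpow_eq_sum_walks sum_product del: walks.simps)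
  show "integrable M (\<lambda>w. P k i j w * cnj (P k i' j' w))"
    unfolding eq using assms by (intro Bochner_Integration.integrable_sum walk_moments(1)[where i = i and i' = i'])
  have "expectation (\<lambda>w. P k i j w * cnj (P k i' j' w)) = (\<Sum>es\<in>walks N k i j. \<Sum>fs\<in>walks N k i' j'.
      expectation (\<lambda>w. prod_list (map (\<lambda>e. Z e w) es) * cnj (prod_list (map (\<lambda>e. Z e w) fs))))"
    unfolding eq using walk_moments(1)[OF _ _ assms]
    by (subst Bochner_Integration.integral_sum, intro Bochner_Integration.integrable_sum, blast)
       (intro sum.cong refl Bochner_Integration.integral_sum, blast)
  also have "\<dots> = (\<Sum>es\<in>walks N k i j. \<Sum>fs\<in>walks N k i' j'.
      complex_of_real (real (if mset es = mset fs then \<Prod>e\<in>E. fact (count (mset es) e) else 0) / real N ^ k))"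
    using walk_moments(2)[OF _ _ assms] by (intro sum.cong refl) blast
  finally show "expectation (\<lambda>w. P k i j w * cnj (P k i' j' w)) =
      complex_of_real (real (\<Sum>es\<in>walks N k i j. \<Sum>fs\<in>walks N k i' j'.
        if mset es = mset fs then \<Prod>e\<in>E. fact (count (mset es) e) else 0) / real N ^ k)"
    by (simp only: of_real_sum[symmetric] sum_divide_distrib[symmetric] of_nat_sum[symmetric])
qed

text \<open>
  No walk between one pair of ends has the same edges as a walk between the other, unless both
  walks are closed. This is why diagonal entries are excluded.
\<close>

lemma matpow_uncorrelated:
  assumes "i < N" "i' < N" "i \<noteq> i' \<or> j \<noteq> j'" "i \<noteq> j \<or> i' \<noteq> j'"
  shows "expectation (\<lambda>w. P k i j w * cnj (P k i' j' w)) = 0"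
proof -
  have "(\<Sum>es\<in>walks N k i j. \<Sum>fs\<in>walks N k i' j'.
        if mset es = mset fs then \<Prod>e\<in>E. fact (count (mset es) e) else 0 :: nat) = 0"
  proof (intro sum.neutral ballI)
    fix es fs assume "es \<in> walks N k i j" "fs \<in> walks N k i' j'"
    then have "mset es \<noteq> mset fs"
      using walks_same_edges assms(3,4) by blast
    then show "(if mset es = mset fs then \<Prod>e\<in>E. fact (count (mset es) e) else 0 :: nat) = 0" by simp
  qed
  then show ?thesis
    using matpow_covariance(2)[OF assms(1,2)] by (simp only: of_nat_0 div_0 of_real_0)
qed

text \<open>
  The number of pairs of walks is of order \<open>N\<^bsup>k-1\<^esup>\<close>, against the factor \<open>N\<^bsup>-k\<^esup>\<close> from the
  variances. So an entry of \<open>X\<^sup>k\<close> stays as small as an entry of \<open>X\<close> for all \<open>k\<close> up to \<open>\<surd>N\<close>.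
\<close>

lemma matpow_second_moment:
  assumes "i < N"
  shows integrable_matpow_square: "integrable M (\<lambda>w. (cmod (P k i j w))\<^sup>2)"
    and "1 \<le> k \<Longrightarrow> k\<^sup>2 \<le> N \<Longrightarrow> expectation (\<lambda>w. (cmod (P k i j w))\<^sup>2) \<le> 3 / real N"
proof -
  have eq: "(cmod (P k i j w))\<^sup>2 = Re (P k i j w * cnj (P k i j w))" for w
    by (metis Re_complex_of_real complex_norm_square)
  show "integrable M (\<lambda>w. (cmod (P k i j w))\<^sup>2)"
    unfolding eq using matpow_covariance(1)[OF assms assms] by (rule integrable_Re)
  assume k: "1 \<le> k" "k\<^sup>2 \<le> N"
  then obtain l where l: "k = Suc l" by (cases k) auto
  have "l\<^sup>2 \<le> N"
  proof -
    have "l\<^sup>2 \<le> k\<^sup>2" unfolding l by (intro power_mono) auto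
    then show ?thesis using k(2) by linarith
  qed
  let ?S = "\<Sum>es\<in>walks N k i j. \<Sum>fs\<in>walks N k i j.
        if mset es = mset fs then \<Prod>e\<in>E. fact (count (mset es) e) else 0 :: nat"
  have "expectation (\<lambda>w. (cmod (P k i j w))\<^sup>2) = Re (expectation (\<lambda>w. P k i j w * cnj (P k i j w)))"
    unfolding eq using matpow_covariance(1)[OF assms assms] by (rule integral_Re)
  also have "\<dots> = real ?S / real N ^ k"
    unfolding matpow_covariance(2)[OF assms assms] by (simp only: Re_complex_of_real)
  also have "\<dots> \<le> real (\<Prod>m=1..l. N + m) / real N ^ k"
    using sum_walk_pairs_same_edges[OF assms, of l j] unfolding l
    by (intro divide_right_mono) (simp_all only: of_nat_le_iff zero_le_power of_nat_0_le_iff)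
  also have "\<dots> \<le> 3 * real N ^ l / real N ^ k"
    using prod_add_le_power[OF N_pos \<open>l\<^sup>2 \<le> N\<close>] by (intro divide_right_mono) auto
  also have "\<dots> = 3 / real N"
    using N_pos by (simp add: l)
  finally show "expectation (\<lambda>w. (cmod (P k i j w))\<^sup>2) \<le> 3 / real N" .
qed

end

section \<open>Resolvent expansion of the outlier\<close>

definition vec_norm :: "nat \<Rightarrow> (nat \<Rightarrow> complex) \<Rightarrow> real" where
  "vec_norm N v = sqrt (\<Sum>i<N. (cmod (v i))\<^sup>2)"

definition frob :: "nat \<Rightarrow> (nat \<Rightarrow> nat \<Rightarrow> complex) \<Rightarrow> real" where
  "frob N A = sqrt (\<Sum>i<N. \<Sum>j<N. (cmod (A i j))\<^sup>2)"

lemma vec_norm_nonneg [simp]: "0 \<le> vec_norm N v" and frob_nonneg [simp]: "0 \<le> frob N A"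
  by (simp_all add: vec_norm_def frob_def sum_nonneg)

lemma vec_norm_add_le: "vec_norm N (\<lambda>i. v i + w i) \<le> vec_norm N v + vec_norm N w"
proof -
  have "vec_norm N (\<lambda>i. v i + w i) \<le> L2_set (\<lambda>i. cmod (v i) + cmod (w i)) {..<N}"
    unfolding vec_norm_def L2_set_def[symmetric] by (intro L2_set_mono norm_triangle_ineq) auto
  also have "\<dots> \<le> vec_norm N v + vec_norm N w"
    unfolding vec_norm_def L2_set_def[symmetric] by (rule L2_set_triangle_ineq)
  finally show ?thesis .
qed

lemma vec_norm_scale: "vec_norm N (\<lambda>i. c * v i) = cmod c * vec_norm N v"
  unfolding vec_norm_def
  by (simp add: norm_mult power_mult_distrib sum_distrib_left[symmetric] real_sqrt_mult)

lemma vec_norm_sum_le: "vec_norm N (\<lambda>i. \<Sum>m\<in>A. f m i) \<le> (\<Sum>m\<in>A. vec_norm N (f m))"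
proof (induct A rule: infinite_finite_induct)
  case (insert m A)
  then show ?case
    using vec_norm_add_le[of N "f m" "\<lambda>i. \<Sum>m\<in>A. f m i"] by simp
qed (simp_all add: vec_norm_def)

lemma cmod_sum_mult_le:
  "(cmod (\<Sum>i<N. a i * b i))\<^sup>2 \<le> (\<Sum>i<N. (cmod (a i))\<^sup>2) * (\<Sum>i<N. (cmod (b i))\<^sup>2)"
proof -
  have "cmod (\<Sum>i<N. a i * b i) \<le> (\<Sum>i<N. cmod (a i) * cmod (b i))"
    by (rule order_trans[OF norm_sum]) (simp add: norm_mult)
  then have "(cmod (\<Sum>i<N. a i * b i))\<^sup>2 \<le> (\<Sum>i<N. cmod (a i) * cmod (b i))\<^sup>2"
    by (intro power_mono) auto
  also have "\<dots> \<le> (\<Sum>i<N. (cmod (a i))\<^sup>2) * (\<Sum>i<N. (cmod (b i))\<^sup>2)"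
    by (rule Cauchy_Schwarz_ineq_sum)
  finally show ?thesis .
qed

lemma cmod_inner_le: "cmod (\<Sum>i<N. cnj (u i) * v i) \<le> vec_norm N u * vec_norm N v"
  using real_sqrt_le_mono[OF cmod_sum_mult_le[of "\<lambda>i. cnj (u i)" v N]]
  by (simp add: vec_norm_def real_sqrt_mult)

lemma vec_norm_mult_le: "vec_norm N (\<lambda>i. \<Sum>j<N. A i j * v j) \<le> frob N A * vec_norm N v"
proof -
  have "(\<Sum>i<N. (cmod (\<Sum>j<N. A i j * v j))\<^sup>2)
      \<le> (\<Sum>i<N. (\<Sum>j<N. (cmod (A i j))\<^sup>2) * (\<Sum>j<N. (cmod (v j))\<^sup>2))"
    by (intro sum_mono cmod_sum_mult_le)
  then show ?thesis
    unfolding vec_norm_def frob_def real_sqrt_mult[symmetric] sum_distrib_right[symmetric]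
    by (rule real_sqrt_le_mono)
qed

text \<open>
  The finite Neumann expansion of \<open>v = (z - X)\<^sup>-\<^sup>1 u\<close>, multiplied by \<open>z\<^sup>K\<close>. No convergence is
  involved; the remainder is the term with \<open>X\<^sup>K v\<close>.
\<close>

lemma power_times_solution:
  assumes sol: "\<And>i. i < N \<Longrightarrow> z * v i = (\<Sum>j<N. x (i, j) * v j) + u i"
    and "i < N"
  shows "z ^ K * v i = (\<Sum>j<N. matpow N x K i j * v j)
    + (\<Sum>m<K. z ^ (K - 1 - m) * (\<Sum>j<N. matpow N x m i j * u j))"
  using \<open>i < N\<close>
proof (induct K arbitrary: i)
  case 0
  have "(\<Sum>j<N. (if i = j then 1 else 0) * v j) = (\<Sum>j<N. if j = i then v j else 0)"
    by (intro sum.cong) auto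
  then show ?case using 0 by simp
next
  case (Suc K)
  let ?X = "\<lambda>m i f. \<Sum>j<N. matpow N x m i j * f j"
  have X: "(\<Sum>l<N. x (i, l) * ?X m l f) = ?X (Suc m) i f" for m f
  proof -
    have "(\<Sum>l<N. x (i, l) * ?X m l f) = (\<Sum>l<N. \<Sum>j<N. x (i, l) * matpow N x m l j * f j)"
      by (simp add: sum_distrib_left mult.assoc)
    also have "\<dots> = (\<Sum>j<N. \<Sum>l<N. x (i, l) * matpow N x m l j * f j)"
      by (rule sum.swap)
    finally show ?thesis by (simp add: sum_distrib_right)
  qed
  have "z ^ Suc K * v i = z ^ K * (z * v i)" by simp
  also have "\<dots> = (\<Sum>l<N. x (i, l) * (z ^ K * v l)) + z ^ K * u i"
    by (subst sol[OF Suc.prems]) (simp add: algebra_simps sum_distrib_left)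
  also have "(\<Sum>l<N. x (i, l) * (z ^ K * v l))
      = (\<Sum>l<N. x (i, l) * (?X K l v + (\<Sum>m<K. z ^ (K - 1 - m) * ?X m l u)))"
    using Suc.hyps by (intro sum.cong refl) simp
  also have "\<dots> = (\<Sum>l<N. x (i, l) * ?X K l v)
      + (\<Sum>l<N. \<Sum>m<K. z ^ (K - 1 - m) * (x (i, l) * ?X m l u))"
    by (simp only: distrib_left sum.distrib sum_distrib_left mult.left_commute)
  also have "(\<Sum>l<N. \<Sum>m<K. z ^ (K - 1 - m) * (x (i, l) * ?X m l u))
      = (\<Sum>m<K. z ^ (K - 1 - m) * (\<Sum>l<N. x (i, l) * ?X m l u))"
    by (subst sum.swap) (simp only: sum_distrib_left)
  finally have "z ^ Suc K * v i = ?X (Suc K) i v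
      + ((\<Sum>m<K. z ^ (K - 1 - m) * ?X (Suc m) i u) + z ^ K * u i)"
    by (simp only: X add.assoc)
  also have "(\<Sum>m<K. z ^ (K - 1 - m) * ?X (Suc m) i u) + z ^ K * u i
      = (\<Sum>m<Suc K. z ^ (Suc K - 1 - m) * ?X m i u)"
  proof -
    have "?X 0 i u = (\<Sum>j<N. if j = i then u j else 0)"
      by (intro sum.cong) auto
    then have "?X 0 i u = u i" using Suc.prems by simp
    then show ?thesis
      by (subst sum.lessThan_Suc_shift) (simp del: matpow.simps)
  qed
  finally show ?case .
qed

text \<open>
  For \<open>|z| > \<rho>\<close> let \<open>R = \<rho>\<^bsup>-K\<^esup> \<parallel>X\<^sup>K\<parallel>\<close>. If \<open>R \<le> 1/2\<close>, the
  remainder of the Neumann expansion can be absorbed, which bounds \<open>v\<close>; pairing the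
  expansion with \<open>u\<close> then gives \<open>z = 1 + \<Sum>\<^bsub>m\<^esub> z\<^bsup>-m\<^esup> u\<^sup>*X\<^sup>m u\<close> up to
  an error of at most \<open>2 R \<Sum>\<^bsub>m\<^esub> \<parallel>X\<^sup>m\<parallel>\<close>. If \<open>R > 1/2\<close>, the
  trivial bound by the norm of the spiked matrix is good enough, since it may be multiplied by \<open>2 R\<close>.
  The second bound thus holds without any case distinction, and its expectation can be
  taken term by term.
\<close>

lemma cmod_outlier_le:
  fixes x :: "nat \<times> nat \<Rightarrow> complex"
  assumes u: "vec_norm N u = 1"
    and sol: "\<And>i. i < N \<Longrightarrow> z * v i = (\<Sum>j<N. x (i, j) * v j) + u i"
    and uv: "(\<Sum>i<N. cnj (u i) * v i) = 1"
    and K: "2 \<le> K" and \<rho>: "1 \<le> \<rho>" and N: "1 \<le> N"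
  shows "cmod z \<le> frob N (matpow N x 1) + 1"
    and "cmod z \<le> \<rho>
      + (\<Sum>m=1..<K. (1 / \<rho>) ^ m * cmod (\<Sum>i<N. cnj (u i) * (\<Sum>j<N. matpow N x m i j * u j)))
      + 2 * (frob N (matpow N x K) * (1 / \<rho>) ^ K) * (\<Sum>m<K. frob N (matpow N x m))"
proof -
  let ?X = "\<lambda>m f i. \<Sum>j<N. matpow N x m i j * f j"
  define w where "w = (\<lambda>m. \<Sum>i<N. cnj (u i) * ?X m u i)"
  define Y where "Y = (\<Sum>m<K. frob N (matpow N x m))"
  define R where "R = frob N (matpow N x K) * (1 / \<rho>) ^ K"
  have vpos: "1 \<le> vec_norm N v"
    using cmod_inner_le[of u v N] by (simp add: uv u)
  have x1: "matpow N x 1 i j = x (i, j)" if "j < N" for i j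
  proof -
    have "matpow N x 1 i j = (\<Sum>l<N. x (i, l) * (if l = j then 1 else 0))"
      by simp
    also have "\<dots> = (\<Sum>l<N. if l = j then x (i, l) else 0)"
      by (intro sum.cong) auto
    finally show ?thesis using that by (simp del: matpow.simps)
  qed
  have zv: "cmod z * vec_norm N v \<le> (frob N (matpow N x 1) + 1) * vec_norm N v"
  proof -
    have "cmod z * vec_norm N v = vec_norm N (\<lambda>i. z * v i)"
      by (simp add: vec_norm_scale)
    also have "\<dots> = vec_norm N (\<lambda>i. ?X 1 v i + u i)"
      unfolding vec_norm_def using sol x1
      by (intro arg_cong[of _ _ sqrt] sum.cong refl) simp
    also have "\<dots> \<le> frob N (matpow N x 1) * vec_norm N v + 1"
      using vec_norm_add_le[of N "?X 1 v" u] vec_norm_mult_le[of N "matpow N x 1" v] u by linarith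
    also have "\<dots> \<le> (frob N (matpow N x 1) + 1) * vec_norm N v"
      using vpos by (simp add: distrib_right)
    finally show ?thesis .
  qed
  then show z1: "cmod z \<le> frob N (matpow N x 1) + 1"
    using vpos by (simp add: mult_le_cancel_right)
  have Y0: "0 \<le> Y" and R0: "0 \<le> R"
    using \<rho> by (simp_all add: Y_def R_def sum_nonneg)
  have S0: "0 \<le> (\<Sum>m=1..<K. (1 / \<rho>) ^ m * cmod (w m))"
    using \<rho> by (intro sum_nonneg) simp
  have "cmod z \<le> \<rho> + (\<Sum>m=1..<K. (1 / \<rho>) ^ m * cmod (w m)) + 2 * R * Y"
  proof (cases "cmod z \<le> \<rho>")
    case True
    then show ?thesis using S0 mult_nonneg_nonneg[OF R0 Y0] by linarith
  next
    case False
    then have z: "\<rho> < cmod z" by simp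
    have z0: "z \<noteq> 0" and zpos: "0 < cmod z" using z \<rho> by auto
    have inv: "(1 / cmod z) ^ m \<le> (1 / \<rho>) ^ m" for m
      using z \<rho> by (intro power_mono) (auto simp: frac_le)
    have pw: "z ^ (K - 1 - m) / z ^ K = 1 / z ^ Suc m" if "m < K" for m
    proof -
      have "K = (K - 1 - m) + Suc m" using that by simp
      then have "z ^ K = z ^ (K - 1 - m) * z ^ Suc m" by (metis power_add)
      then show ?thesis using z0 by (simp del: power_Suc)
    qed
    define b where "b = (\<lambda>i. 1 / z ^ K * ?X K v i + (\<Sum>m<K. 1 / z ^ Suc m * ?X m u i))"
    have v: "v i = b i" if "i < N" for i
    proof -
      have "v i = (z ^ K * v i) / z ^ K" using z0 by simp
      also have "\<dots> = 1 / z ^ K * ?X K v i + (\<Sum>m<K. z ^ (K - 1 - m) / z ^ K * ?X m u i)"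
        unfolding power_times_solution[OF sol that, of K, simplified]
        by (simp add: add_divide_distrib sum_divide_distrib)
      also have "(\<Sum>m<K. z ^ (K - 1 - m) / z ^ K * ?X m u i) = (\<Sum>m<K. 1 / z ^ Suc m * ?X m u i)"
        by (intro sum.cong refl) (simp only: pw lessThan_iff)
      finally show ?thesis unfolding b_def .
    qed
    show ?thesis
    proof (cases "R \<le> 1 / 2")
      case True
      have "vec_norm N v = vec_norm N b"
        unfolding vec_norm_def by (intro arg_cong[of _ _ sqrt] sum.cong refl) (simp only: v lessThan_iff)
      also have "\<dots> \<le> (1 / cmod z) ^ K * (frob N (matpow N x K) * vec_norm N v)
          + (\<Sum>m<K. (1 / cmod z) ^ Suc m * frob N (matpow N x m))"
        unfolding b_def
      proof (rule order_trans[OF vec_norm_add_le], rule add_mono)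
        show "vec_norm N (\<lambda>i. 1 / z ^ K * ?X K v i) \<le> (1 / cmod z) ^ K * (frob N (matpow N x K) * vec_norm N v)"
          unfolding vec_norm_scale norm_divide norm_one norm_power power_one_over[symmetric]
          by (intro mult_left_mono vec_norm_mult_le) simp
        show "vec_norm N (\<lambda>i. \<Sum>m<K. 1 / z ^ Suc m * ?X m u i)
            \<le> (\<Sum>m<K. (1 / cmod z) ^ Suc m * frob N (matpow N x m))"
          unfolding power_one_over
        proof (rule order_trans[OF vec_norm_sum_le], rule sum_mono)
          fix m
          have "vec_norm N (?X m u) \<le> frob N (matpow N x m)"
            using vec_norm_mult_le[of N "matpow N x m" u] u by simp
          then show "vec_norm N (\<lambda>i. 1 / z ^ Suc m * ?X m u i)
              \<le> 1 / cmod z ^ Suc m * frob N (matpow N x m)"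
            unfolding vec_norm_scale norm_divide norm_one norm_power
            by (intro mult_left_mono) auto
        qed
      qed
      also have "(1 / cmod z) ^ K * (frob N (matpow N x K) * vec_norm N v) \<le> 1 / 2 * vec_norm N v"
      proof -
        have "(1 / cmod z) ^ K * frob N (matpow N x K) \<le> R"
          unfolding R_def mult.commute[of "frob N (matpow N x K)"] by (intro mult_right_mono inv) simp
        then show ?thesis
          using True mult_right_mono[of "(1 / cmod z) ^ K * frob N (matpow N x K)" "1/2" "vec_norm N v"]
          by (simp add: mult.assoc)
      qed
      also have "(\<Sum>m<K. (1 / cmod z) ^ Suc m * frob N (matpow N x m)) \<le> (\<Sum>m<K. 1 / cmod z * frob N (matpow N x m))"
      proof (intro sum_mono mult_right_mono)
        fix m
        have "(1 / cmod z) ^ m \<le> 1"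
          using z \<rho> by (intro power_le_one) (simp_all add: divide_le_eq_1)
        then show "(1 / cmod z) ^ Suc m \<le> 1 / cmod z"
          using zpos mult_left_mono[of "(1 / cmod z) ^ m" 1 "1 / cmod z"] by simp
      qed simp
      also have "\<dots> = Y / cmod z" by (simp add: Y_def sum_divide_distrib)
      finally have vle: "vec_norm N v \<le> 2 * (Y / cmod z)" by simp
      have "1 = (\<Sum>i<N. cnj (u i) * b i)"
        unfolding uv[symmetric] by (intro sum.cong refl) (simp only: v lessThan_iff)
      also have "\<dots> = 1 / z ^ K * (\<Sum>i<N. cnj (u i) * ?X K v i) + (\<Sum>m<K. 1 / z ^ Suc m * w m)"
      proof -
        have "(\<Sum>i<N. cnj (u i) * (\<Sum>m<K. 1 / z ^ Suc m * ?X m u i)) = (\<Sum>m<K. 1 / z ^ Suc m * w m)"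
          unfolding w_def sum_distrib_left by (subst sum.swap) (simp only: mult.left_commute)
        then show ?thesis
          unfolding b_def distrib_left sum.distrib
          by (simp only: sum_distrib_left[symmetric] mult.left_commute[of "cnj _" "1 / z ^ K"])
      qed
      finally have one: "1 = 1 / z ^ K * (\<Sum>i<N. cnj (u i) * ?X K v i) + (\<Sum>m<K. 1 / z ^ Suc m * w m)" .
      have w0: "w 0 = 1"
      proof -
        have "?X 0 u i = u i" if "i < N" for i
        proof -
          have "?X 0 u i = (\<Sum>j<N. if j = i then u j else 0)"
            by (intro sum.cong) auto
          then show ?thesis using that by simp
        qed
        then have "w 0 = (\<Sum>i<N. complex_of_real ((cmod (u i))\<^sup>2))"
          unfolding w_def complex_norm_square mult.commute[of "u _" "cnj _"]
          by (intro sum.cong refl) (simp only: lessThan_iff)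
        also have "\<dots> = complex_of_real ((vec_norm N u)\<^sup>2)"
          by (simp add: vec_norm_def sum_nonneg)
        finally show ?thesis by (simp add: u)
      qed
      have "z = z * (1 / z ^ K * (\<Sum>i<N. cnj (u i) * ?X K v i)) + (\<Sum>m<K. 1 / z ^ m * w m)"
      proof -
        have "z = z * (1 / z ^ K * (\<Sum>i<N. cnj (u i) * ?X K v i)) + z * (\<Sum>m<K. 1 / z ^ Suc m * w m)"
          using arg_cong[OF one, of "\<lambda>y. z * y"] by (simp only: distrib_left mult_1_right)
        moreover have "z * (\<Sum>m<K. 1 / z ^ Suc m * w m) = (\<Sum>m<K. 1 / z ^ m * w m)"
          using z0 by (simp add: sum_distrib_left)
        ultimately show ?thesis by simp
      qed
      also have "(\<Sum>m<K. 1 / z ^ m * w m) = 1 + (\<Sum>m=1..<K. 1 / z ^ m * w m)"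
        using K w0 by (subst lessThan_atLeast0, subst sum.atLeast_Suc_lessThan) auto
      finally have zeq: "z = z * (1 / z ^ K * (\<Sum>i<N. cnj (u i) * ?X K v i)) + (1 + (\<Sum>m=1..<K. 1 / z ^ m * w m))" .
      have "cmod z \<le> cmod (z * (1 / z ^ K * (\<Sum>i<N. cnj (u i) * ?X K v i)))
          + (1 + cmod (\<Sum>m=1..<K. 1 / z ^ m * w m))"
        using arg_cong[OF zeq, of cmod] norm_triangle_ineq[of "z * (1 / z ^ K * (\<Sum>i<N. cnj (u i) * ?X K v i))" "1 + (\<Sum>m=1..<K. 1 / z ^ m * w m)"]
          norm_triangle_ineq[of 1 "\<Sum>m=1..<K. 1 / z ^ m * w m"] unfolding norm_one by linarith
      also have "cmod (\<Sum>m=1..<K. 1 / z ^ m * w m) \<le> (\<Sum>m=1..<K. (1 / \<rho>) ^ m * cmod (w m))"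
      proof (rule order_trans[OF norm_sum], rule sum_mono)
        fix m
        show "cmod (1 / z ^ m * w m) \<le> (1 / \<rho>) ^ m * cmod (w m)"
          using mult_right_mono[OF inv[of m], of "cmod (w m)"]
          by (simp add: norm_mult norm_divide norm_power power_one_over)
      qed
      also have "cmod (z * (1 / z ^ K * (\<Sum>i<N. cnj (u i) * ?X K v i))) \<le> 2 * R * Y"
      proof -
        have "cmod (\<Sum>i<N. cnj (u i) * ?X K v i) \<le> frob N (matpow N x K) * vec_norm N v"
          using cmod_inner_le[of u "?X K v" N] vec_norm_mult_le[of N "matpow N x K" v] u by simp
        also have "\<dots> \<le> frob N (matpow N x K) * (2 * (Y / cmod z))"
          by (intro mult_left_mono vle) simp
        finally have "cmod (z * (1 / z ^ K * (\<Sum>i<N. cnj (u i) * ?X K v i)))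
            \<le> cmod z * ((1 / cmod z) ^ K * (frob N (matpow N x K) * (2 * (Y / cmod z))))"
          by (simp only: norm_mult norm_divide norm_power norm_one power_one_over)
            (intro mult_left_mono, auto)
        also have "\<dots> = (1 / cmod z) ^ K * (frob N (matpow N x K) * (2 * Y))"
          using zpos by simp
        also have "\<dots> \<le> (1 / \<rho>) ^ K * (frob N (matpow N x K) * (2 * Y))"
          using inv[of K] Y0 by (intro mult_right_mono) auto
        finally show ?thesis by (simp add: R_def mult_ac)
      qed
      finally show ?thesis using \<rho> by linarith
    next
      case False
      \<comment> \<open>As the identity has norm at least \<open>1\<close>, the terms \<open>m = 0\<close> and \<open>m = 1\<close> of the sum already add up to at least \<open>\<parallel>X\<parallel> + 1\<close>; this is why \<open>K \<ge> 2\<close>.\<close>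
      have "1 \<le> frob N (matpow N x 0)"
      proof -
        have "(\<Sum>i<N. \<Sum>j<N. (cmod (matpow N x 0 i j))\<^sup>2) = (\<Sum>i<N. \<Sum>j<N. if i = j then 1 else 0)"
          by (intro sum.cong) auto
        then show ?thesis using N by (simp add: frob_def del: matpow.simps)
      qed
      moreover have "frob N (matpow N x 0) + frob N (matpow N x 1) \<le> Y"
        unfolding Y_def using K sum_mono2[of "{..<K}" "{0, 1}" "\<lambda>m. frob N (matpow N x m)"] by auto
      ultimately have "cmod z \<le> Y" using z1 by linarith
      moreover have "1 * Y \<le> (2 * R) * Y"
        using False Y0 by (intro mult_right_mono) auto
      ultimately show ?thesis using S0 \<rho> by linarith
    qed
  qed
  then show "cmod z \<le> \<rho>
      + (\<Sum>m=1..<K. (1 / \<rho>) ^ m * cmod (\<Sum>i<N. cnj (u i) * (\<Sum>j<N. matpow N x m i j * u j)))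
      + 2 * (frob N (matpow N x K) * (1 / \<rho>) ^ K) * (\<Sum>m<K. frob N (matpow N x m))"
    unfolding w_def R_def Y_def .
qed

section \<open>Quadratic forms and the expected modulus of the outlier\<close>

lemma expectation_square_uncorrelated:
  fixes Y :: "'i \<Rightarrow> 'w \<Rightarrow> complex" and a :: "'i \<Rightarrow> complex"
  assumes "finite I"
    and int: "\<And>p q. p \<in> I \<Longrightarrow> q \<in> I \<Longrightarrow> integrable M (\<lambda>w. Y p w * cnj (Y q w))"
    and unc: "\<And>p q. p \<in> I \<Longrightarrow> q \<in> I \<Longrightarrow> p \<noteq> q \<Longrightarrow> (\<integral>w. Y p w * cnj (Y q w) \<partial>M) = 0"
  shows "integrable M (\<lambda>w. (cmod (\<Sum>p\<in>I. a p * Y p w))\<^sup>2)"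
    and "(\<integral>w. (cmod (\<Sum>p\<in>I. a p * Y p w))\<^sup>2 \<partial>M) = (\<Sum>p\<in>I. (cmod (a p))\<^sup>2 * (\<integral>w. (cmod (Y p w))\<^sup>2 \<partial>M))"
proof -
  have sq: "(cmod c)\<^sup>2 = Re (c * cnj c)" for c
    by (metis Re_complex_of_real complex_norm_square)
  have eq: "(\<Sum>p\<in>I. a p * Y p w) * cnj (\<Sum>p\<in>I. a p * Y p w)
      = (\<Sum>p\<in>I. \<Sum>q\<in>I. (a p * cnj (a q)) * (Y p w * cnj (Y q w)))" for w
    by (simp add: sum_product mult_ac)
  have int': "integrable M (\<lambda>w. \<Sum>p\<in>I. \<Sum>q\<in>I. (a p * cnj (a q)) * (Y p w * cnj (Y q w)))"
    using int by (intro Bochner_Integration.integrable_sum integrable_mult_right)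
  then show "integrable M (\<lambda>w. (cmod (\<Sum>p\<in>I. a p * Y p w))\<^sup>2)"
    unfolding sq eq by (rule integrable_Re)
  have "(\<integral>w. (cmod (\<Sum>p\<in>I. a p * Y p w))\<^sup>2 \<partial>M)
      = Re (\<integral>w. (\<Sum>p\<in>I. \<Sum>q\<in>I. (a p * cnj (a q)) * (Y p w * cnj (Y q w))) \<partial>M)"
    unfolding sq eq using int' by (rule integral_Re)
  also have "(\<integral>w. (\<Sum>p\<in>I. \<Sum>q\<in>I. (a p * cnj (a q)) * (Y p w * cnj (Y q w))) \<partial>M)
      = (\<Sum>p\<in>I. \<Sum>q\<in>I. (a p * cnj (a q)) * (\<integral>w. Y p w * cnj (Y q w) \<partial>M))"
    using int by (simp add: Bochner_Integration.integral_sum)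
  also have "\<dots> = (\<Sum>p\<in>I. (a p * cnj (a p)) * (\<integral>w. Y p w * cnj (Y p w) \<partial>M))"
  proof (intro sum.cong refl)
    fix p assume p: "p \<in> I"
    have "(\<Sum>q\<in>I. (a p * cnj (a q)) * (\<integral>w. Y p w * cnj (Y q w) \<partial>M))
      = (\<Sum>q\<in>{p}. (a p * cnj (a q)) * (\<integral>w. Y p w * cnj (Y q w) \<partial>M))"
      using p assms(1) unc by (intro sum.mono_neutral_right) auto
    then show "(\<Sum>q\<in>I. (a p * cnj (a q)) * (\<integral>w. Y p w * cnj (Y q w) \<partial>M))
      = (a p * cnj (a p)) * (\<integral>w. Y p w * cnj (Y p w) \<partial>M)" by simp
  qed
  also have "Re \<dots> = (\<Sum>p\<in>I. (cmod (a p))\<^sup>2 * (\<integral>w. (cmod (Y p w))\<^sup>2 \<partial>M))"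
    unfolding Re_sum
  proof (intro sum.cong refl)
    fix p assume p: "p \<in> I"
    have "(\<integral>w. (cmod (Y p w))\<^sup>2 \<partial>M) = Re (\<integral>w. Y p w * cnj (Y p w) \<partial>M)"
      unfolding sq using int[OF p p] by (rule integral_Re)
    moreover have "a p * cnj (a p) = complex_of_real ((cmod (a p))\<^sup>2)"
      by (rule complex_norm_square[symmetric])
    ultimately show "Re (a p * cnj (a p) * (\<integral>w. Y p w * cnj (Y p w) \<partial>M))
        = (cmod (a p))\<^sup>2 * (\<integral>w. (cmod (Y p w))\<^sup>2 \<partial>M)"
      by (simp only: Re_complex_of_real Im_complex_of_real times_complex.sel mult_zero_left diff_0_right)
  qed
  finally show "(\<integral>w. (cmod (\<Sum>p\<in>I. a p * Y p w))\<^sup>2 \<partial>M)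
      = (\<Sum>p\<in>I. (cmod (a p))\<^sup>2 * (\<integral>w. (cmod (Y p w))\<^sup>2 \<partial>M))" .
qed

lemma sum_geometric_le:
  fixes s :: real
  assumes "0 < s"
  shows "(\<Sum>m=1..<K. (1 / (1 + s)) ^ m) \<le> 1 / s"
proof -
  let ?q = "1 / (1 + s)"
  have "s * (\<Sum>m=1..n. ?q ^ m) + ?q ^ n = 1" for n
  proof (induct n)
    case (Suc n)
    have "s * ?q ^ Suc n + ?q ^ Suc n = ?q ^ n"
    proof -
      have "s * ?q ^ Suc n + ?q ^ Suc n = ((1 + s) * ?q) * ?q ^ n" by (simp add: distrib_right del: times_divide_eq_right)
      then show ?thesis using assms by simp
    qed
    then show ?case using Suc by (simp add: distrib_left del: power_Suc)
  qed simp
  from this[of "K - 1"] have "s * (\<Sum>m=1..K - 1. ?q ^ m) \<le> 1"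
    using assms zero_le_power[of ?q "K - 1"] by (smt (verit) divide_nonneg_nonneg)
  moreover have "{1..<K} = {1..K - 1}" by auto
  ultimately show ?thesis
    using assms by (simp add: field_simps)
qed

context complex_normal_entries
begin

abbreviation "quad u k w \<equiv> \<Sum>i<N. cnj (u i) * (\<Sum>j<N. P k i j w * u j)"

text \<open>
  The diagonal entries of \<open>X\<^sup>k\<close> may be correlated with each other, but their weights \<open>|u\<^sub>i|\<^sup>2\<close> sum to one,
  so convexity of the square suffices for them. The off-diagonal entries are orthogonal. Each part
  contributes at most \<open>2 * (3 / N)\<close>.
\<close>

lemma quad_second_moment:
  assumes u: "vec_norm N u = 1" and k: "1 \<le> k" "k\<^sup>2 \<le> N"
  shows "integrable M (\<lambda>w. (cmod (quad u k w))\<^sup>2)"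
    and "expectation (\<lambda>w. (cmod (quad u k w))\<^sup>2) \<le> 12 / real N"
proof -
  define I where "I = {p \<in> E. fst p \<noteq> snd p}"
  define a where "a = (\<lambda>p. cnj (u (fst p)) * u (snd p))"
  define Y where "Y = (\<lambda>p w. P k (fst p) (snd p) w)"
  define D where "D = (\<lambda>w. \<Sum>i<N. a (i, i) * Y (i, i) w)"
  define Off where "Off = (\<lambda>w. \<Sum>p\<in>I. a p * Y p w)"
  let ?B = "\<lambda>w. \<Sum>i<N. (cmod (u i))\<^sup>2 * (cmod (P k i i w))\<^sup>2"
  have u1: "(\<Sum>i<N. (cmod (u i))\<^sup>2) = 1"
    using u by (simp add: vec_norm_def)
  have Q: "quad u k w = D w + Off w" for w
  proof -
    have "quad u k w = (\<Sum>p\<in>E. a p * Y p w)"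
      by (simp add: a_def Y_def sum.cartesian_product sum_distrib_left case_prod_beta mult_ac)
    also have "\<dots> = (\<Sum>p\<in>E - I. a p * Y p w) + Off w"
      unfolding Off_def by (rule sum.subset_diff) (auto simp: I_def)
    also have "E - I = (\<lambda>i. (i, i)) ` {..<N}"
      by (auto simp: I_def)
    also have "(\<Sum>p\<in>(\<lambda>i. (i, i)) ` {..<N}. a p * Y p w) = D w"
      unfolding D_def by (subst sum.reindex) (auto simp: inj_on_def)
    finally show ?thesis .
  qed
  have D: "(cmod (D w))\<^sup>2 \<le> ?B w" for w
  proof -
    have "D w = (\<Sum>i<N. complex_of_real (cmod (u i)) * (complex_of_real (cmod (u i)) * P k i i w))"
      unfolding D_def
    proof (intro sum.cong refl)
      fix i
      have "a (i, i) = complex_of_real (cmod (u i)) * complex_of_real (cmod (u i))"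
        unfolding a_def by (simp add: complex_norm_square[symmetric] power2_eq_square[symmetric] mult.commute[of "cnj _"])
      then show "a (i, i) * Y (i, i) w = complex_of_real (cmod (u i)) * (complex_of_real (cmod (u i)) * P k i i w)"
        by (simp add: Y_def)
    qed
    then show ?thesis
      using cmod_sum_mult_le[of "\<lambda>i. complex_of_real (cmod (u i))" "\<lambda>i. complex_of_real (cmod (u i)) * P k i i w" N]
      by (simp add: u1 norm_mult power_mult_distrib)
  qed
  have intB: "integrable M ?B"
    using integrable_matpow_square by (intro Bochner_Integration.integrable_sum integrable_mult_right) auto
  have EB: "expectation ?B \<le> 3 / real N"
  proof -
    have "expectation ?B = (\<Sum>i<N. (cmod (u i))\<^sup>2 * expectation (\<lambda>w. (cmod (P k i i w))\<^sup>2))"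
      using integrable_matpow_square by (subst Bochner_Integration.integral_sum) auto
    also have "\<dots> \<le> (\<Sum>i<N. (cmod (u i))\<^sup>2 * (3 / real N))"
      using matpow_second_moment(2)[OF _ k] by (intro sum_mono mult_left_mono) auto
    finally show ?thesis by (simp only: sum_distrib_right[symmetric] u1)
  qed
  have orth: "integrable M (\<lambda>w. (cmod (Off w))\<^sup>2)"
    "expectation (\<lambda>w. (cmod (Off w))\<^sup>2) = (\<Sum>p\<in>I. (cmod (a p))\<^sup>2 * expectation (\<lambda>w. (cmod (Y p w))\<^sup>2))"
  proof -
    have fI: "finite I" by (simp add: I_def)
    have i: "integrable M (\<lambda>w. Y p w * cnj (Y q w))" if "p \<in> I" "q \<in> I" for p q
      unfolding Y_def using that by (intro matpow_covariance) (auto simp: I_def)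
    have o: "expectation (\<lambda>w. Y p w * cnj (Y q w)) = 0" if "p \<in> I" "q \<in> I" "p \<noteq> q" for p q
      unfolding Y_def using that by (intro matpow_uncorrelated) (auto simp: I_def prod_eq_iff)
    show "integrable M (\<lambda>w. (cmod (Off w))\<^sup>2)"
      unfolding Off_def by (rule expectation_square_uncorrelated[OF fI i o])
    show "expectation (\<lambda>w. (cmod (Off w))\<^sup>2) = (\<Sum>p\<in>I. (cmod (a p))\<^sup>2 * expectation (\<lambda>w. (cmod (Y p w))\<^sup>2))"
      unfolding Off_def by (rule expectation_square_uncorrelated[OF fI i o])
  qed
  have EO: "expectation (\<lambda>w. (cmod (Off w))\<^sup>2) \<le> 3 / real N"
  proof -
    have "(\<Sum>p\<in>I. (cmod (a p))\<^sup>2 * expectation (\<lambda>w. (cmod (Y p w))\<^sup>2)) \<le> (\<Sum>p\<in>I. (cmod (a p))\<^sup>2 * (3 / real N))"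
      unfolding Y_def using matpow_second_moment(2)[OF _ k] by (intro sum_mono mult_left_mono) (auto simp: I_def)
    also have "\<dots> \<le> (\<Sum>p\<in>E. (cmod (a p))\<^sup>2 * (3 / real N))"
      by (intro sum_mono2) (auto simp: I_def)
    also have "(\<Sum>p\<in>E. (cmod (a p))\<^sup>2 * (3 / real N)) = 3 / real N"
    proof -
      have "(\<Sum>p\<in>E. (cmod (a p))\<^sup>2) = (\<Sum>i<N. \<Sum>j<N. (cmod (u i))\<^sup>2 * (cmod (u j))\<^sup>2)"
        by (simp add: a_def sum.cartesian_product case_prod_beta norm_mult power_mult_distrib)
      also have "\<dots> = 1"
        by (simp add: sum_product[symmetric] u1)
      finally show ?thesis by (simp only: sum_distrib_right[symmetric])
    qed
    finally show ?thesis using orth(2) by simp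
  qed
  have le: "(cmod (quad u k w))\<^sup>2 \<le> 2 * ?B w + 2 * (cmod (Off w))\<^sup>2" for w
  proof -
    have "(cmod (D w + Off w))\<^sup>2 \<le> (cmod (D w) + cmod (Off w))\<^sup>2"
      by (intro power_mono norm_triangle_ineq) auto
    also have "\<dots> \<le> 2 * (cmod (D w))\<^sup>2 + 2 * (cmod (Off w))\<^sup>2"
      using sum_squares_bound[of "cmod (D w)" "cmod (Off w)"] by (simp add: power2_sum)
    finally show ?thesis using D[of w] by (simp only: Q)
  qed
  have int_bd: "integrable M (\<lambda>w. 2 * ?B w + 2 * (cmod (Off w))\<^sup>2)"
    using intB orth(1) by auto
  show int: "integrable M (\<lambda>w. (cmod (quad u k w))\<^sup>2)"
    by (rule Bochner_Integration.integrable_bound[OF int_bd])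
       (measurable, use le in \<open>auto intro!: AE_I2 order_trans[OF _ abs_ge_self]\<close>)
  have "expectation (\<lambda>w. (cmod (quad u k w))\<^sup>2) \<le> expectation (\<lambda>w. 2 * ?B w + 2 * (cmod (Off w))\<^sup>2)"
    using int int_bd le by (intro integral_mono)
  also have "\<dots> = 2 * expectation ?B + 2 * expectation (\<lambda>w. (cmod (Off w))\<^sup>2)"
    using intB orth(1) by (subst Bochner_Integration.integral_add) auto
  also have "\<dots> \<le> 12 / real N"
    using EB EO by (simp add: field_simps)
  finally show "expectation (\<lambda>w. (cmod (quad u k w))\<^sup>2) \<le> 12 / real N" .
qed

lemma quad_first_moment:
  assumes u: "vec_norm N u = 1" and k: "1 \<le> k" "k\<^sup>2 \<le> N"
  shows "integrable M (\<lambda>w. cmod (quad u k w))"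
    and "expectation (\<lambda>w. cmod (quad u k w)) \<le> sqrt (12 / real N)"
proof -
  define c where "c = sqrt (12 / real N)"
  have c: "0 < c" "c\<^sup>2 = 12 / real N" using N_pos by (auto simp: c_def)
  \<comment> \<open>The arithmetic-geometric mean inequality in place of Cauchy-Schwarz, with \<open>c\<close> the bound on the root mean square.\<close>
  have le: "cmod (quad u k w) \<le> (cmod (quad u k w))\<^sup>2 / (2 * c) + c / 2" for w
    using sum_squares_bound[of "cmod (quad u k w)" c] c(1) by (simp add: field_simps power2_eq_square)
  note i2 = quad_second_moment(1)[OF assms]
  have int_bd: "integrable M (\<lambda>w. (cmod (quad u k w))\<^sup>2 / (2 * c) + c / 2)"
    using i2 by auto
  show int: "integrable M (\<lambda>w. cmod (quad u k w))"
    by (rule Bochner_Integration.integrable_bound[OF int_bd])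
       (measurable, use le in \<open>auto intro!: AE_I2 order_trans[OF _ abs_ge_self]\<close>)
  have "expectation (\<lambda>w. cmod (quad u k w)) \<le> expectation (\<lambda>w. (cmod (quad u k w))\<^sup>2 / (2 * c) + c / 2)"
    using int int_bd le by (intro integral_mono)
  also have "\<dots> = expectation (\<lambda>w. (cmod (quad u k w))\<^sup>2) / (2 * c) + c / 2"
    using i2 by (subst Bochner_Integration.integral_add) (auto simp: prob_space)
  also have "\<dots> \<le> c\<^sup>2 / (2 * c) + c / 2"
    using quad_second_moment(2)[OF assms] c by (intro add_right_mono divide_right_mono) auto
  also have "\<dots> = c" using c(1) by (simp add: power2_eq_square)
  finally show "expectation (\<lambda>w. cmod (quad u k w)) \<le> sqrt (12 / real N)" unfolding c_def .
qed

lemma frob_second_moment: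
  shows integrable_frob_square: "integrable M (\<lambda>w. (frob N (\<lambda>i j. P k i j w))\<^sup>2)"
    and "k\<^sup>2 \<le> N \<Longrightarrow> expectation (\<lambda>w. (frob N (\<lambda>i j. P k i j w))\<^sup>2) \<le> 3 * real N"
proof -
  have eq: "(frob N (\<lambda>i j. P k i j w))\<^sup>2 = (\<Sum>i<N. \<Sum>j<N. (cmod (P k i j w))\<^sup>2)" for w
    by (simp add: frob_def sum_nonneg)
  show "integrable M (\<lambda>w. (frob N (\<lambda>i j. P k i j w))\<^sup>2)"
    unfolding eq using integrable_matpow_square by (intro Bochner_Integration.integrable_sum) auto
  assume k: "k\<^sup>2 \<le> N"
  show "expectation (\<lambda>w. (frob N (\<lambda>i j. P k i j w))\<^sup>2) \<le> 3 * real N"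
  proof (cases "k = 0")
    case True
    have "(\<Sum>i<N. \<Sum>j<N. (cmod (P k i j w))\<^sup>2) = (\<Sum>i<N. \<Sum>j<N. if i = j then 1 else 0)" for w
      unfolding True by (intro sum.cong) auto
    then show ?thesis unfolding eq by (simp add: prob_space)
  next
    case False
    have "expectation (\<lambda>w. (frob N (\<lambda>i j. P k i j w))\<^sup>2) = (\<Sum>i<N. \<Sum>j<N. expectation (\<lambda>w. (cmod (P k i j w))\<^sup>2))"
      unfolding eq using integrable_matpow_square
      by (subst Bochner_Integration.integral_sum) (auto intro!: sum.cong Bochner_Integration.integral_sum)
    also have "\<dots> \<le> (\<Sum>i<N. \<Sum>j<N. 3 / real N)"
      using False k by (intro sum_mono matpow_second_moment(2)) auto
    finally show ?thesis using N_pos by simp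
  qed
qed

text \<open>
  The sum over \<open>m\<close> has expected size \<open>N\<^bsup>-1/2\<^esup> \<Sum>\<^bsub>m\<^esub> (1 + s)\<^bsup>-m\<^esup> \<le> N\<^bsup>-1/2\<^esup> / s\<close>. Balancing it against \<open>s\<close>
  gives \<open>s = N\<^bsup>-1/4\<^esup>\<close>. The last term is the cost of cutting the expansion at \<open>K\<close>.
\<close>

lemma expectation_outlier_le:
  assumes u: "vec_norm N u = 1" and [measurable]: "z \<in> borel_measurable M"
    and z: "AE w in M. \<exists>v. (\<forall>i<N. z w * v i = (\<Sum>j<N. Z (i, j) w * v j) + u i) \<and> (\<Sum>i<N. cnj (u i) * v i) = 1"
  shows "integrable M (\<lambda>w. cmod (z w))"
    and "\<lbrakk>2 \<le> K; K\<^sup>2 \<le> N; 0 < s\<rbrakk> \<Longrightarrow> expectation (\<lambda>w. cmod (z w))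
      \<le> 1 + s + sqrt (12 / real N) / s + 6 * (real N)\<^sup>2 * (1 / (1 + s)) ^ K"
proof -
  let ?F = "\<lambda>k w. frob N (\<lambda>i j. P k i j w)"
  show int: "integrable M (\<lambda>w. cmod (z w))"
  proof (rule Bochner_Integration.integrable_bound)
    show "integrable M (\<lambda>w. (?F 1 w)\<^sup>2 + 2)"
      using integrable_frob_square[of 1] by simp
    show "AE w in M. norm (cmod (z w)) \<le> norm ((?F 1 w)\<^sup>2 + 2)"
      using z
    proof eventually_elim
      case (elim w)
      then obtain v where "\<And>i. i < N \<Longrightarrow> z w * v i = (\<Sum>j<N. Z (i, j) w * v j) + u i"
        "(\<Sum>i<N. cnj (u i) * v i) = 1" by blast
      from cmod_outlier_le(1)[OF u this order_refl order_refl N_pos]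
      have "cmod (z w) \<le> ?F 1 w + 1" .
      moreover have "?F 1 w \<le> (?F 1 w)\<^sup>2 + 1"
        using sum_squares_bound[of "?F 1 w" 1] by (smt (verit) zero_le_power2 mult_2 mult_1_right one_power2)
      ultimately show ?case by simp
    qed
  qed simp
  assume K: "2 \<le> K" "K\<^sup>2 \<le> N" and s: "0 < s"
  let ?q = "1 / (1 + s)"
  let ?S = "\<lambda>w. \<Sum>m=1..<K. ?q ^ m * cmod (quad u m w)"
  let ?T = "\<lambda>w. \<Sum>m<K. ?q ^ K * ((?F K w)\<^sup>2 + (?F m w)\<^sup>2)"
  have q: "0 \<le> ?q" using s by simp
  have small: "m\<^sup>2 \<le> N" if "m \<le> K" for m
    using power_mono[OF that, of 2] K(2) by linarith
  have intS: "integrable M ?S"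
    using quad_first_moment(1)[OF u] small
    by (intro Bochner_Integration.integrable_sum integrable_mult_right) auto
  have intT: "integrable M ?T"
    using integrable_frob_square
    by (intro Bochner_Integration.integrable_sum integrable_mult_right Bochner_Integration.integrable_add) auto
  have "AE w in M. cmod (z w) \<le> 1 + s + ?S w + ?T w"
    using z
  proof eventually_elim
    case (elim w)
    then obtain v where "\<And>i. i < N \<Longrightarrow> z w * v i = (\<Sum>j<N. Z (i, j) w * v j) + u i"
      "(\<Sum>i<N. cnj (u i) * v i) = 1" by blast
    from cmod_outlier_le(2)[OF u this K(1) _ N_pos, of "1 + s"] s
    have "cmod (z w) \<le> 1 + s + ?S w + 2 * (?F K w * ?q ^ K) * (\<Sum>m<K. ?F m w)"
      by simp
    also have "2 * (?F K w * ?q ^ K) * (\<Sum>m<K. ?F m w) = (\<Sum>m<K. ?q ^ K * (2 * ?F K w * ?F m w))"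
      by (simp add: sum_distrib_left mult_ac)
    also have "\<dots> \<le> ?T w"
      using q by (intro sum_mono mult_left_mono sum_squares_bound) auto
    finally show ?case by simp
  qed
  then have "expectation (\<lambda>w. cmod (z w)) \<le> expectation (\<lambda>w. 1 + s + ?S w + ?T w)"
    using int intS intT by (intro integral_mono_AE) auto
  also have "\<dots> = 1 + s + expectation ?S + expectation ?T"
    using intS intT by (simp add: prob_space del: Bochner_Integration.integral_sum)
  also have "expectation ?S \<le> sqrt (12 / real N) / s"
  proof -
    have "expectation ?S = (\<Sum>m=1..<K. ?q ^ m * expectation (\<lambda>w. cmod (quad u m w)))"
      using quad_first_moment(1)[OF u] small by (subst Bochner_Integration.integral_sum) auto
    also have "\<dots> \<le> (\<Sum>m=1..<K. ?q ^ m * sqrt (12 / real N))"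
      using quad_first_moment(2)[OF u] small q by (intro sum_mono mult_left_mono) auto
    also have "\<dots> \<le> 1 / s * sqrt (12 / real N)"
      unfolding sum_distrib_right[symmetric] by (intro mult_right_mono sum_geometric_le s) simp
    finally show ?thesis by simp
  qed
  also have "expectation ?T \<le> 6 * (real N)\<^sup>2 * ?q ^ K"
  proof -
    have "expectation ?T = (\<Sum>m<K. ?q ^ K * (expectation (\<lambda>w. (?F K w)\<^sup>2) + expectation (\<lambda>w. (?F m w)\<^sup>2)))"
      using integrable_frob_square by (subst Bochner_Integration.integral_sum) auto
    also have "\<dots> \<le> (\<Sum>m<K. ?q ^ K * (3 * real N + 3 * real N))"
      using q small by (intro sum_mono mult_left_mono add_mono frob_second_moment(2)) auto
    also have "\<dots> = real K * (6 * real N * ?q ^ K)" by simp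
    also have "\<dots> \<le> real N * (6 * real N * ?q ^ K)"
    proof (rule mult_right_mono)
      have "K \<le> K\<^sup>2" using K(1) by (simp add: power2_eq_square)
      then show "real K \<le> real N" using K(2) by linarith
    qed (use q in simp)
    finally show ?thesis by (simp add: power2_eq_square mult_ac)
  qed
  finally show "expectation (\<lambda>w. cmod (z w))
      \<le> 1 + s + sqrt (12 / real N) / s + 6 * (real N)\<^sup>2 * (1 / (1 + s)) ^ K" by simp
qed

end

section \<open>From matrices to arrays, and the choice of parameters\<close>

text \<open>
  An eigenvector \<open>x\<close> of the spiked matrix satisfies \<open>(z - X) x = (u\<^sup>* x) u\<close>. As \<open>z\<close> is not an eigenvalue
  of \<open>X\<close>, the scalar \<open>u\<^sup>* x\<close> is nonzero, and \<open>x / (u\<^sup>* x)\<close> is \<open>(z - X)\<^sup>-\<^sup>1 u\<close>.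
\<close>

lemma outlier_resolvent_vector:
  assumes X: "X \<in> carrier_mat N N" and u: "u \<in> carrier_vec N" and z: "is_outlier X u z"
  shows "\<exists>v. (\<forall>i<N. z * v i = (\<Sum>j<N. X $$ (i, j) * v j) + vec_index u i) \<and> (\<Sum>i<N. cnj (vec_index u i) * v i) = 1"
proof -
  have dim: "dim_row (spiked X u) = N"
    using u by (simp add: spiked_def rank_one_proj_def)
  obtain x where x: "x \<in> carrier_vec N" "x \<noteq> 0\<^sub>v N" and ev: "spiked X u *\<^sub>v x = z \<cdot>\<^sub>v x"
    using z unfolding is_outlier_def eigenvalue_def eigenvector_def dim by blast
  define c where "c = (\<Sum>j<N. cnj (vec_index u j) * vec_index x j)"
  have row: "z * vec_index x i = (\<Sum>j<N. X $$ (i, j) * vec_index x j) + vec_index u i * c" if i: "i < N" for i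
  proof -
    have "z * vec_index x i = vec_index (spiked X u *\<^sub>v x) i"
      using x i ev by simp
    also have "\<dots> = (\<Sum>j<N. (X $$ (i, j) + vec_index u i * cnj (vec_index u j)) * vec_index x j)"
      using X u x i by (auto simp: spiked_def rank_one_proj_def scalar_prod_def lessThan_atLeast0 intro!: sum.cong)
    finally show ?thesis
      by (simp add: c_def sum_distrib_left sum.distrib algebra_simps)
  qed
  have "c \<noteq> 0"
  proof
    assume "c = 0"
    have "X *\<^sub>v x = z \<cdot>\<^sub>v x"
    proof (rule eq_vecI)
      fix i assume "i < dim_vec (z \<cdot>\<^sub>v x)"
      then have i: "i < N" using x by simp
      then show "vec_index (X *\<^sub>v x) i = vec_index (z \<cdot>\<^sub>v x) i"
        using row[OF i] X x \<open>c = 0\<close> by (simp add: scalar_prod_def lessThan_atLeast0)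
    qed (use X x in simp)
    then have "eigenvalue X z"
      unfolding eigenvalue_def eigenvector_def using X x by auto
    then show False using z by (simp add: is_outlier_def)
  qed
  show ?thesis
  proof (intro exI[of _ "\<lambda>i. vec_index x i / c"] conjI allI impI)
    fix i assume "i < N"
    from row[OF this] show "z * (vec_index x i / c) = (\<Sum>j<N. X $$ (i, j) * (vec_index x j / c)) + vec_index u i"
      using \<open>c \<noteq> 0\<close> by (simp add: sum_divide_distrib[symmetric] add_divide_distrib)
  next
    show "(\<Sum>i<N. cnj (vec_index u i) * (vec_index x i / c)) = 1"
      using \<open>c \<noteq> 0\<close> by (simp add: c_def sum_divide_distrib[symmetric])
  qed
qed

lemma unit_cvec_norm:
  assumes "unit_cvec N u"
  shows "vec_norm N (vec_index u) = 1"
proof -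
  have "complex_of_real (\<Sum>i<N. (cmod (vec_index u i))\<^sup>2) = (\<Sum>i<N. vec_index u i * cnj (vec_index u i))"
    unfolding of_real_sum by (intro sum.cong refl complex_norm_square)
  also have "\<dots> = u \<bullet>c u"
    using assms by (auto simp: unit_cvec_def scalar_prod_def lessThan_atLeast0 intro!: sum.cong)
  also have "\<dots> = 1" using assms by (simp add: unit_cvec_def)
  finally have "(\<Sum>i<N. (cmod (vec_index u i))\<^sup>2) = 1"
    by (simp only: of_real_eq_1_iff)
  then show ?thesis by (simp add: vec_norm_def)
qed

text \<open>
  With \<open>K\<close> the integer part of \<open>\<surd>N\<close>, the factor \<open>(1 + N\<^bsup>-1/4\<^esup>)\<^bsup>-K\<^esup>\<close> decays like
  \<open>exp (- N\<^bsup>1/4\<^esup>)\<close> to first order in the exponent and beats every power of \<open>N\<close>.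
\<close>

lemma eventually_error_small:
  "eventually (\<lambda>N. 1 + real N powr (- 1 / 4) + sqrt (12 / real N) / real N powr (- 1 / 4)
      + 6 * (real N)\<^sup>2 * (1 / (1 + real N powr (- 1 / 4))) ^ nat \<lfloor>sqrt (real N)\<rfloor>
    \<le> 1 + 6 * real N powr (- 1 / 4)) sequentially"
proof -
  have "eventually (\<lambda>N. 6 * (real N)\<^sup>2 * (1 / (1 + real N powr (- 1 / 4))) powr (sqrt (real N) - 1)
      \<le> real N powr (- 1 / 4)) sequentially"
    by real_asymp
  moreover have "eventually (\<lambda>N::nat. 1 \<le> N) sequentially"
    by (rule eventually_ge_at_top)
  ultimately show ?thesis
  proof eventually_elim
    case (elim N)
    let ?q = "1 / (1 + real N powr (- 1 / 4))" and ?K = "nat \<lfloor>sqrt (real N)\<rfloor>"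
    have q: "0 < ?q" "?q \<le> 1" by (simp_all add: add_pos_nonneg)
    have sqrt_term: "sqrt (12 / real N) / real N powr (- 1 / 4) \<le> 4 * real N powr (- 1 / 4)"
    proof -
      have "real N powr (- 1 / 4) * real N powr (- 1 / 4) = 1 / sqrt (real N)"
        using elim by (simp add: powr_add[symmetric] powr_minus powr_half_sqrt field_simps)
      moreover have "sqrt (12 / real N) \<le> 4 * (1 / sqrt (real N))"
      proof -
        have "sqrt 12 \<le> (4::real)"
          by (rule real_le_lsqrt) auto
        then show ?thesis by (simp add: real_sqrt_divide divide_right_mono)
      qed
      moreover have "0 < real N powr (- 1 / 4)" using elim by simp
      ultimately show ?thesis
        by (simp only: pos_divide_le_eq mult.assoc)
    qed
    have "sqrt (real N) - 1 \<le> real ?K" by linarith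
    then have "?q ^ ?K \<le> ?q powr (sqrt (real N) - 1)"
      using q by (subst powr_realpow[symmetric]) (auto intro: powr_mono')
    then have "6 * (real N)\<^sup>2 * ?q ^ ?K \<le> 6 * (real N)\<^sup>2 * ?q powr (sqrt (real N) - 1)"
      by (intro mult_left_mono) auto
    then show ?case using elim sqrt_term by linarith
  qed
qed

theorem theorem1p3:
  fixes M :: "nat \<Rightarrow> 'w measure"
    and X :: "nat \<Rightarrow> 'w \<Rightarrow> complex mat"
    and u :: "nat \<Rightarrow> complex vec"
    and z_out :: "nat \<Rightarrow> 'w \<Rightarrow> complex"
  assumes "\<And>N. N \<ge> 1 \<Longrightarrow> prob_space (M N)"
    and "\<And>N. N \<ge> 1 \<Longrightarrow> ginibre (M N) N (X N)"
    and "\<And>N. N \<ge> 1 \<Longrightarrow> unit_cvec N (u N)"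
    and "\<And>N. N \<ge> 1 \<Longrightarrow> z_out N \<in> borel_measurable (M N)"
    and "\<And>N. N \<ge> 1 \<Longrightarrow> AE w in M N. is_outlier (X N w) (u N) (z_out N w)"
  shows "\<exists>c0::real. c0 > 0 \<and>
    (\<exists>r::nat \<Rightarrow> real. r \<in> o(\<lambda>N. real N powr (- 1 / 4)) \<and>
      (\<forall>N\<ge>1. integrable (M N) (\<lambda>w. Re (z_out N w)) \<and>
        prob_space.expectation (M N) (\<lambda>w. Re (z_out N w))
          \<le> 1 + c0 * real N powr (- 1 / 4) + r N))"
proof -
  define e where "e = (\<lambda>N. prob_space.expectation (M N) (\<lambda>w. Re (z_out N w)))"
  \<comment> \<open>The excess over the bound vanishes for all large \<open>N\<close>; small \<open>N\<close> are absorbed here.\<close>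
  define r where "r = (\<lambda>N. max 0 (e N - 1 - 6 * real N powr (- 1 / 4)))"
  have int: "integrable (M N) (\<lambda>w. Re (z_out N w))"
    and bound: "2 \<le> K \<Longrightarrow> K\<^sup>2 \<le> N \<Longrightarrow> 0 < s \<Longrightarrow>
      e N \<le> 1 + s + sqrt (12 / real N) / s + 6 * (real N)\<^sup>2 * (1 / (1 + s)) ^ K"
    if N: "1 \<le> N" for N K and s :: real
  proof -
    interpret prob_space "M N" by (rule assms(1)[OF N])
    define Z where "Z = (\<lambda>e w. X N w $$ e)"
    have G: "\<And>w. w \<in> space (M N) \<Longrightarrow> X N w \<in> carrier_mat N N"
      "indep_vars (\<lambda>_. borel) Z ({..<N} \<times> {..<N})"
      "\<And>e. e \<in> {..<N} \<times> {..<N} \<Longrightarrow> distributed (M N) lborel (Z e) (\<lambda>z. ennreal (complex_normal_density (1 / real N) z))"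
      using assms(2)[OF N] by (auto simp: ginibre_def Z_def case_prod_unfold)
    interpret complex_normal_entries "M N" N Z
      by unfold_locales (use G N in auto)
    have u: "vec_norm N (vec_index (u N)) = 1" "u N \<in> carrier_vec N"
      using assms(3)[OF N] by (simp_all add: unit_cvec_norm) (simp add: unit_cvec_def)
    have [measurable]: "z_out N \<in> borel_measurable (M N)" by (rule assms(4)[OF N])
    have z: "AE w in M N. \<exists>v. (\<forall>i<N. z_out N w * v i = (\<Sum>j<N. Z (i, j) w * v j) + vec_index (u N) i)
        \<and> (\<Sum>i<N. cnj (vec_index (u N) i) * v i) = 1"
      using assms(5)[OF N] AE_space
    proof eventually_elim
      case (elim w)
      then show ?case
        using outlier_resolvent_vector[OF G(1) u(2)] by (simp add: Z_def)
    qed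
    note i = expectation_outlier_le(1)[OF u(1) _ z, simplified]
    show int: "integrable (M N) (\<lambda>w. Re (z_out N w))"
      by (rule Bochner_Integration.integrable_bound[OF i]) (auto intro: abs_Re_le_cmod)
    have "e N \<le> expectation (\<lambda>w. cmod (z_out N w))"
      unfolding e_def using int i by (intro integral_mono complex_Re_le_cmod)
    then show "e N \<le> 1 + s + sqrt (12 / real N) / s + 6 * (real N)\<^sup>2 * (1 / (1 + s)) ^ K"
      if "2 \<le> K" "K\<^sup>2 \<le> N" "0 < s"
      using expectation_outlier_le(2)[OF u(1) _ z that] by simp
  qed
  have "eventually (\<lambda>N. e N \<le> 1 + 6 * real N powr (- 1 / 4)) sequentially"
    using eventually_error_small eventually_ge_at_top[of 4]
  proof eventually_elim
    case (elim N)
    let ?K = "nat \<lfloor>sqrt (real N)\<rfloor>"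
    have "sqrt 4 \<le> sqrt (real N)" using elim(2) by (intro real_sqrt_le_mono) simp
    then have K2: "2 \<le> ?K" by (simp add: le_nat_iff le_floor_iff)
    have "real ?K \<le> sqrt (real N)" by simp
    then have "(real ?K)\<^sup>2 \<le> (sqrt (real N))\<^sup>2" by (intro power_mono) auto
    then have "real (?K\<^sup>2) \<le> real N" by simp
    then have "?K\<^sup>2 \<le> N" by (simp only: of_nat_le_iff)
    from bound[OF _ K2 this, of "real N powr (- 1 / 4)"] elim show ?case by simp
  qed
  then have "eventually (\<lambda>N. r N = 0) sequentially"
    by eventually_elim (simp add: r_def)
  then have "r \<in> o(\<lambda>N. real N powr (- 1 / 4))"
    by (subst landau_o.small.in_cong) auto
  moreover have "e N \<le> 1 + 6 * real N powr (- 1 / 4) + r N" for N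
    by (simp add: r_def)
  ultimately show ?thesis
    using int unfolding e_def by (intro exI[of _ 6] conjI exI[of _ r]) auto
qed

end
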